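(* Consider the CWENOZ reconstruction on a stencil of $2r-1$ cells, with parameters $\epsilon=\epsilon(h)>0$, $t\ge1$, and global smoothness indicator $\tau$. If $$\theta(\epsilon)\le\theta(\tau)-\frac{r-1}{t},$$ then the CWENOZ scheme achieves the optimal order $2r-1$ as $h\to0$, regardless of the presence of critical points. That is, when the cell averages are those of a sufficiently smooth function $u$, the reconstruction polynomial satisfies $P_{\mathrm{rec}}(x)=u(x)+\mathcal{O}(h^{2r-1})$ uniformly for $x\in\Omega_0$, whether or not derivatives of $u$ vanish at points of the stencil.
   Context: Grid and data. The grid is uniform with cell size $h>0$; the reference cell is $\Omega_0=[-h/2,h/2]$ and $\Omega_i=[(i-\tfrac12)h,(i+\tfrac12)h]$ for $i\in\mathbb{Z}$. The data are the cell averages $\overline{u}_i=\frac1h\int_{\Omega_i}u(x)\,dx$ of a function $u$. Polynomials. Let $r>1$ be an integer. Let $\mathbb{S}_0=\{-r+1,\dots,r-1\}$ and, for $k=1,\dots,r$, $\mathbb{S}_k=\{-r+k,\dots,k-1\}$. $P_{\mathrm{opt}}$ is the polynomial of degree at most $2r-2$ with $\int_{\Omega_j}P_{\mathrm{opt}}(x)\,dx=h\overline{u}_j$ for all $j\in\mathbb{S}_0$; for $k=1,\dots,r$, $P_k$ is the polynomial of degree at most $r-1$ with $\int_{\Omega_j}P_k(x)\,dx=h\overline{u}_j$ for all $j\in\mathbb{S}_k$. Smoothness indicators. For a polynomial $P$, the Jiang–Shu indicator is $$I[P]=\sum_{l\ge1}h^{2l-1}\int_{\Omega_0}\left(\frac{d^l}{dx^l}P(x)\right)^2dx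 .$$ CWENOZ reconstruction. Let $d_0,\dots,d_r\in(0,1)$ be fixed coefficients (independent of $h$) with $\sum_{k=0}^r d_k=1$, let $\epsilon>0$ be a small quantity, and $t\ge1$. Define $$P_0(x)=\frac1{d_0}\Big(P_{\mathrm{opt}}(x)-\sum_{k=1}^r d_kP_k(x)\Big),$$ $$\alpha_k^Z=d_k\left(1+\left(\frac{\tau}{I[P_k]+\epsilon}\right)^t\right),\qquad \omega_k^Z=\frac{\alpha_k^Z}{\sum_{i=0}^r\alpha_i^Z},\qquad k=0,\dots,r,$$ $$P_{\mathrm{rec}}(x)=\sum_{k=0}^r\omega_k^Z P_k(x).$$ Notation $\theta$. For a quantity $g(h)$, $\theta(g)$ denotes the power of $h$ in the leading term of its expansion as $h\to0$; in particular $\epsilon$ behaves like a positive constant times $h^{\theta(\epsilon)}$. Global smoothness indicator. $\tau$ is the absolute value of a suitable linear combination of $I_k:=I[P_k]$, $k=1,\dots,r$. Two choices are considered, the standard one and the optimal one (denoted $\tau^{\mathrm{opt}}$), with the following leading truncation orders $\theta$ for smooth data (so that $\tau=\mathcal{O}(h^{\theta(\tau)})$). Standard choice: $r=3$: $\tau=|I_1-I_3|$, $\theta(\tau)=5$; $r=4$: $\tau=|I_1-I_2-I_3+I_4|$, $\theta(\tau)=6$; $r=5$: $\tau=|I_1-I_5|$, $\theta(\tau)=7$; $r=6$: $\tau=|I_1-I_2-I_5+I_6|$, $\theta(\tau)=8$ (no standard choice for $r=2$). Optimal choice: $r=2$: $\tau=|I_1-I_2|$, $\theta(\tau)=3$;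 $r=3$: $\tau=|I_1-I_3|$, $\theta(\tau)=5$; $r=4$: $\tau=|I_1+3I_2-3I_3-I_4|$, $\theta(\tau)=7$; $r=5$: $\tau=|I_1+2I_2-6I_3+2I_4+I_5|$, $\theta(\tau)=8$; $r=6$: $\tau=|I_1+I_2-8I_3+8I_4-I_5-I_6|$, $\theta(\tau)=9$. *)

theory Defs
  imports "HOL-Analysis.Analysis" "HOL-Computational_Algebra.Polynomial" "HOL-Library.Landau_Symbols"
begin

definition cell :: "real \<Rightarrow> int \<Rightarrow> real set" where
  "cell h i = {(of_int i - 1/2) * h .. (of_int i + 1/2) * h}"

definition cell_average :: "(real \<Rightarrow> real) \<Rightarrow> real \<Rightarrow> int \<Rightarrow> real" where
  "cell_average u h i = (1 / h) * integral (cell h i) u"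

(* Well defined when J consists of n + 1 cells, h > 0 and u is integrable on them. *)
definition interpolant :: "(real \<Rightarrow> real) \<Rightarrow> real \<Rightarrow> nat \<Rightarrow> int set \<Rightarrow> real poly" where
  "interpolant u h n J =
     (THE p. degree p \<le> n \<and> (\<forall>j\<in>J. integral (cell h j) (poly p) = h * cell_average u h j))"

definition P_opt :: "(real \<Rightarrow> real) \<Rightarrow> real \<Rightarrow> nat \<Rightarrow> real poly" where
  "P_opt u h r = interpolant u h (2 * r - 2) {- int r + 1 .. int r - 1}"

(* The polynomial P_k on the k-th substencil, for k = 1, ..., r. *)
definition P_sub :: "(real \<Rightarrow> real) \<Rightarrow> real \<Rightarrow> nat \<Rightarrow> nat \<Rightarrow> real poly" where
  "P_sub u h r k = interpolant u h (r - 1) {- int r + int k .. int k - 1}"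

(* The Jiang-Shu indicator; derivatives of order l > degree P vanish, so the
   sum over all l \<ge> 1 is this finite one. *)
definition smoothness :: "real \<Rightarrow> real poly \<Rightarrow> real" where
  "smoothness h P =
     (\<Sum>l = 1..degree P. h ^ (2 * l - 1) * integral (cell h 0) (\<lambda>x. (poly ((pderiv ^^ l) P) x)\<^sup>2))"

(* P_0 for k = 0, and P_k for k = 1, ..., r. *)
definition P_cwenoz :: "(real \<Rightarrow> real) \<Rightarrow> real \<Rightarrow> nat \<Rightarrow> (nat \<Rightarrow> real) \<Rightarrow> nat \<Rightarrow> real poly" where
  "P_cwenoz u h r d k =
     (if k = 0
      then smult (1 / d 0) (P_opt u h r - (\<Sum>i = 1..r. smult (d i) (P_sub u h r i)))
      else P_sub u h r k)"

(* The list c = [c_1, ..., c_r] holds the coefficients of the linear combination. *)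
definition tau :: "(real \<Rightarrow> real) \<Rightarrow> real \<Rightarrow> nat \<Rightarrow> real list \<Rightarrow> real" where
  "tau u h r c = \<bar>\<Sum>k = 1..r. c ! (k - 1) * smoothness h (P_sub u h r k)\<bar>"

(* Triples (r, c, \<theta>): c are the coefficients of tau and \<theta> is its leading truncation
   order for smooth data, so that tau = O(h ^ \<theta>). *)
definition tau_standard :: "(nat \<times> real list \<times> nat) set" where
  "tau_standard =
     {(3, [1, 0, -1], 5),
      (4, [1, -1, -1, 1], 6),
      (5, [1, 0, 0, 0, -1], 7),
      (6, [1, -1, 0, 0, -1, 1], 8)}"

definition tau_optimal :: "(nat \<times> real list \<times> nat) set" where
  "tau_optimal =
     {(2, [1, -1], 3),
      (3, [1, 0, -1], 5),
      (4, [1, 3, -3, -1], 7),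
      (5, [1, 2, -6, 2, 1], 8),
      (6, [1, 1, -8, 8, -1, -1], 9)}"

definition alpha_Z :: "(real \<Rightarrow> real) \<Rightarrow> real \<Rightarrow> nat \<Rightarrow> (nat \<Rightarrow> real) \<Rightarrow> real list \<Rightarrow> real \<Rightarrow> real \<Rightarrow> nat \<Rightarrow> real" where
  "alpha_Z u h r d c \<epsilon> t k =
     d k * (1 + (tau u h r c / (smoothness h (P_cwenoz u h r d k) + \<epsilon>)) powr t)"

definition omega_Z :: "(real \<Rightarrow> real) \<Rightarrow> real \<Rightarrow> nat \<Rightarrow> (nat \<Rightarrow> real) \<Rightarrow> real list \<Rightarrow> real \<Rightarrow> real \<Rightarrow> nat \<Rightarrow> real" where
  "omega_Z u h r d c \<epsilon> t k =
     alpha_Z u h r d c \<epsilon> t k / (\<Sum>i = 0..r. alpha_Z u h r d c \<epsilon> t i)"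

definition P_rec :: "(real \<Rightarrow> real) \<Rightarrow> real \<Rightarrow> nat \<Rightarrow> (nat \<Rightarrow> real) \<Rightarrow> real list \<Rightarrow> real \<Rightarrow> real \<Rightarrow> real poly" where
  "P_rec u h r d c \<epsilon> t =
     (\<Sum>k = 0..r. smult (omega_Z u h r d c \<epsilon> t k) (P_cwenoz u h r d k))"

(* Meant for open S only, where deriv is the derivative within S. *)
definition C_k_on :: "nat \<Rightarrow> (real \<Rightarrow> real) \<Rightarrow> real set \<Rightarrow> bool" where
  "C_k_on n u S \<longleftrightarrow>
     (\<forall>m<n. \<forall>x\<in>S. (deriv ^^ m) u field_differentiable (at x)) \<and> continuous_on S ((deriv ^^ n) u)"

end

theory Submission
  imports Defs
begin

text \<open>Write \<open>P\<^sub>k\<close> for the \<open>r + 1\<close> polynomials that are combined, \<open>d\<^sub>k\<close> for the ideal weights and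
\<open>\<omega>\<^sub>k\<close> for the nonlinear ones. As \<open>P_opt\<close> is the combination of the \<open>P\<^sub>k\<close> with weights \<open>d\<^sub>k\<close>,
and both families of weights sum to 1,
\[ P_{rec} - u = (P_{opt} - u) + \sum_k (\omega_k - d_k) (P_k - u). \]
The first term is \<open>O(h^(2r-1))\<close> and each \<open>P\<^sub>k - u\<close> is \<open>O(h^r)\<close>, so it suffices that the
weights deviate from the ideal ones by \<open>O(h^(r-1))\<close>. The deviation is at most the largest of
the quotients \<open>(\<tau> / (I + \<epsilon>))^t\<close>, and because \<open>I \<ge> 0\<close> these are at most \<open>(\<tau> / \<epsilon>)^t\<close>, of
order \<open>h^(t (\<theta>\<tau> - \<theta>\<epsilon>))\<close>. The hypothesis on \<open>\<theta>\<epsilon>\<close> says exactly that this exponent is at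
least \<open>r - 1\<close>. The only fact about the indicators in the denominators that enters is \<open>I \<ge> 0\<close>, so
the estimate is insensitive to their degeneration at critical points of \<open>u\<close>.

The remaining work is the order of \<open>\<tau>\<close> itself (\<open>tau_bigo\<close>, \<open>moments_vanish\<close>). In the variable
\<open>x / h\<close> the indicator becomes a quadratic form \<open>\<langle>q, q\<rangle>\<close> that does not depend on \<open>h\<close>, and the
reconstruction \<open>L\<^sub>k\<close> from cell averages is linear. The Taylor polynomial \<open>A\<close> of degree \<open>r - 1\<close>
is reproduced by every \<open>L\<^sub>k\<close>. So, with \<open>q\<^sub>k\<close> the rescaled \<open>P\<^sub>k\<close>,
\<open>\<langle>q\<^sub>k, q\<^sub>k\<rangle> = 2 \<langle>A, q\<^sub>k\<rangle> - \<langle>A, A\<rangle> + O(h^(2r))\<close>, and if \<open>\<Sum>\<^sub>k c\<^sub>k = 0\<close> the middle term drops out of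
\<open>\<tau>\<close>. The mixed terms are linear functionals of the cell averages and are expanded in
monomials: the coefficient belonging to \<open>h^(i+j)\<close> is the moment \<open>\<Sum>\<^sub>k c\<^sub>k \<langle>y^i, L\<^sub>k y^j\<rangle>\<close>. Hence
\<open>\<tau> = O(h^\<theta>)\<close> for \<open>\<theta> \<le> 2 r\<close> as soon as the moments with \<open>i \<ge> 1\<close> and \<open>i + j < \<theta>\<close> vanish. Three
properties of the coefficients achieve this, each raising the order by one; the tabulated
coefficients have the first \<open>\<theta> - r\<close> of them:
\<^item> \<open>\<Sum>\<^sub>k c\<^sub>k = 0\<close> kills the moments with \<open>j < r\<close>, which gives order \<open>r + 1\<close>;
\<^item> \<open>\<Sum>\<^sub>k c\<^sub>k (-1)^k (k-1)! (r-k)! = 0\<close> says that the moment \<open>(1, r)\<close> vanishes: order \<open>r + 2\<close>;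
\<^item> \<open>c_(r+1-k) = (-1)^(r+1) c\<^sub>k\<close> kills \<open>(1, r+1)\<close> and \<open>(2, r)\<close> by reflection: order \<open>r + 3\<close>.\<close>

section \<open>Cell averages of polynomials\<close>

definition unit_average :: "real poly \<Rightarrow> int \<Rightarrow> real" where
  "unit_average p j = integral (cell 1 j) (poly p)"

abbreviation dilate :: "real \<Rightarrow> real poly \<Rightarrow> real poly" where
  "dilate s p \<equiv> pcompose p [:0, s:]"

lemma degree_dilate_le: "degree (dilate s p) \<le> degree p"
  using degree_pcompose_le[of p "[:0, s:]"] by (cases "s = 0") auto

lemma integrable_poly_cell: "poly (p :: real poly) integrable_on cell h j"
  unfolding cell_def by (intro integrable_continuous_interval continuous_intros)

lemma integral_cell_pderiv:
  assumes "h > 0"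
  shows "integral (cell h j) (poly (pderiv R)) =
    poly R ((of_int j + 1/2) * h) - poly R ((of_int j - 1/2) * h)"
proof -
  have "(poly (pderiv R) has_integral
      poly R ((of_int j + 1/2) * h) - poly R ((of_int j - 1/2) * h)) (cell h j)"
    unfolding cell_def
  proof (rule fundamental_theorem_of_calculus)
    show "(of_int j - 1/2) * h \<le> (of_int j + 1/2) * h"
      using assms by (intro mult_right_mono) auto
    show "(poly R has_vector_derivative poly (pderiv R) x)
        (at x within {(of_int j - 1/2) * h..(of_int j + 1/2) * h})" for x
      using poly_DERIV[of R x]
      by (simp add: has_real_derivative_iff_has_vector_derivative has_vector_derivative_at_within)
  qed
  then show ?thesis by (rule integral_unique)
qed

lemma unit_average_pderiv:
  "unit_average (pderiv R) j = poly R (of_int j + 1/2) - poly R (of_int j - 1/2)"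
  using integral_cell_pderiv[of 1 j R] by (simp add: unit_average_def)

lemma obtain_primitive:
  fixes p :: "real poly"
  obtains R where "pderiv R = p" "degree R \<le> degree p + 1"
proof
  let ?R = "\<Sum>i\<le>degree p. monom (coeff p i / real (Suc i)) (Suc i)"
  show "pderiv ?R = p"
    by (subst (2) poly_as_sum_of_monoms[of p, symmetric])
       (simp add: higher_pderiv_sum[where n = 1, simplified] pderiv_monom del: of_nat_Suc)
  show "degree ?R \<le> degree p + 1"
    by (intro degree_sum_le) (auto intro: order_trans[OF degree_monom_le])
qed

lemma unit_average_add: "unit_average (p + q) j = unit_average p j + unit_average q j"
proof -
  have "poly (p + q) = (\<lambda>x. poly p x + poly q x)" by (rule ext) simp
  then show ?thesis
    using integral_add[OF integrable_poly_cell[of p 1 j] integrable_poly_cell[of q 1 j]]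
    by (simp add: unit_average_def)
qed

lemma unit_average_smult: "unit_average (smult a p) j = a * unit_average p j"
proof -
  have "poly (smult a p) = (\<lambda>x. a * poly p x)" by (rule ext) simp
  then show ?thesis by (simp add: unit_average_def)
qed

lemma unit_average_0 [simp]: "unit_average 0 j = 0"
  using unit_average_smult[of 0 0 j] by simp

lemma unit_average_diff: "unit_average (p - q) j = unit_average p j - unit_average q j"
  using unit_average_add[of p "smult (-1) q" j] unit_average_smult[of "-1" q j] by simp

lemma unit_average_sum: "unit_average (\<Sum>i\<in>A. f i) j = (\<Sum>i\<in>A. unit_average (f i) j)"
  by (induction A rule: infinite_finite_induct) (simp_all add: unit_average_add)

text \<open>Passing to the variable \<open>x / h\<close> turns every cell of the grid of size \<open>h\<close> into a cell of size 1;
this is what makes all constants below independent of \<open>h\<close>.\<close>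

lemma integral_cell_poly:
  assumes "h > 0"
  shows "integral (cell h j) (poly p) = h * unit_average (dilate h p) j"
proof -
  obtain R where R: "pderiv R = p" using obtain_primitive .
  have "pderiv (smult (1 / h) (dilate h R)) = dilate h p"
    using assms R by (simp add: pderiv_smult pderiv_pcompose pderiv_pCons mult.commute)
  then have "unit_average (dilate h p) j = 
     poly (smult (1 / h) (dilate h R)) (of_int j + 1/2) - poly (smult (1 / h) (dilate h R)) (of_int j - 1/2)"
    using unit_average_pderiv by metis
  then show ?thesis
    using integral_cell_pderiv[OF assms, of j R] R assms
    by (simp add: poly_pcompose field_simps)
qed

lemma unit_average_reflect: "unit_average (dilate (-1) p) j = unit_average p (-j)"
proof -
  obtain R where R: "pderiv R = p" using obtain_primitive .
  have "pderiv (smult (-1) (dilate (-1) R)) = dilate (-1) p"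
    using R by (simp add: pderiv_minus pderiv_pcompose pderiv_pCons)
  then have "unit_average (dilate (-1) p) j = 
     poly (smult (-1) (dilate (-1) R)) (of_int j + 1/2) - poly (smult (-1) (dilate (-1) R)) (of_int j - 1/2)"
    using unit_average_pderiv by metis
  then show ?thesis
    using unit_average_pderiv[of R "-j"] R
    by (simp add: poly_pcompose algebra_simps)
qed

section \<open>Reconstruction of a polynomial from cell averages\<close>

text \<open>A primitive of \<open>p\<close> takes the same value at all the \<open>n + 2\<close> cell edges, which is too often for a
nonconstant polynomial of degree at most \<open>n + 1\<close>.\<close>

lemma zero_of_unit_averages_zero:
  assumes "degree p \<le> n" and zero: "\<And>j. j \<in> {a..a + int n} \<Longrightarrow> unit_average p j = 0"
  shows "p = 0"
proof -
  obtain R where R: "pderiv R = p" "degree R \<le> degree p + 1" using obtain_primitive .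
  have const: "poly R (of_int (a + int i) - 1/2) = poly R (of_int a - 1/2)" if "i \<le> n + 1" for i
    using that
  proof (induction i)
    case (Suc i)
    have "unit_average p (a + int i) = 0" using Suc.prems by (intro zero) auto
    then show ?case
      using unit_average_pderiv[of R "a + int i"] R(1) Suc by (simp add: algebra_simps)
  qed simp
  let ?q = "R - [:poly R (of_int a - 1/2):]"
  let ?node = "\<lambda>i. of_int (a + int i) - 1/2 :: real"
  have "?q = 0"
  proof (rule ccontr)
    assume nz: "?q \<noteq> 0"
    have "card (?node ` {..n + 1}) \<le> card {x. poly ?q x = 0}"
    proof (rule card_mono)
      show "finite {x. poly ?q x = 0}" using poly_roots_finite[OF nz] .
      show "?node ` {..n + 1} \<subseteq> {x. poly ?q x = 0}" using const by auto
    qed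
    also have "\<dots> \<le> degree ?q" using card_poly_roots_bound[OF nz] .
    also have "\<dots> \<le> n + 1"
      using R(2) assms(1) by (intro degree_diff_le) auto
    finally show False
      by (subst (asm) card_image) (auto simp: inj_on_def)
  qed
  then have "R = [:poly R (of_int a - 1/2):]" by simp
  then have "pderiv R = 0" by (metis pderiv_singleton)
  with R(1) show ?thesis by simp
qed

lemma lagrange_interpolation_exists:
  assumes "finite (S :: real set)"
  shows "\<exists>p. degree p \<le> card S - 1 \<and> (\<forall>x\<in>S. poly p x = f x)"
  using assms
proof induction
  case empty
  show ?case by (intro exI[of _ 0]) auto
next
  case (insert s S)
  then obtain p where p: "degree p \<le> card S - 1" "\<forall>x\<in>S. poly p x = f x" by blast
  let ?W = "\<Prod>x\<in>S. [:-x, 1:]"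
  let ?c = "(f s - poly p s) / poly ?W s"
  have "poly ?W s \<noteq> 0" using insert by (auto simp: poly_prod)
  moreover have "poly ?W x = 0" if "x \<in> S" for x using that insert by (simp add: poly_prod prod_zero_iff)
  moreover have "degree ?W \<le> card S"
    using degree_prod_sum_le[OF insert(1), of "\<lambda>x. [:-x, 1:]"] by simp
  then have "degree (p + smult ?c ?W) \<le> card (insert s S) - 1"
    using p(1) insert by (intro degree_add_le) (auto intro: order_trans[OF degree_smult_le])
  ultimately show ?case
    using p(2) by (intro exI[of _ "p + smult ?c ?W"]) auto
qed

text \<open>The dual basis to the averages over the cells \<open>a, \<dots>, a + n\<close>.\<close>

definition cardinal_poly :: "nat \<Rightarrow> int \<Rightarrow> int \<Rightarrow> real poly" where
  "cardinal_poly n a j = (SOME p. degree p \<le> n \<and>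
     (\<forall>i\<in>{a..a + int n}. unit_average p i = (if i = j then 1 else 0)))"

text \<open>The required polynomial is the derivative of the one that interpolates, at the \<open>n + 2\<close> cell
edges, the step function jumping from 0 to 1 inside cell \<open>j\<close>.\<close>

lemma cardinal_poly:
  "degree (cardinal_poly n a j) \<le> n"
  "i \<in> {a..a + int n} \<Longrightarrow> unit_average (cardinal_poly n a j) i = (if i = j then 1 else 0)"
proof -
  let ?nodes = "(\<lambda>i. of_int i - 1/2) ` {a..a + int (Suc n)} :: real set"
  obtain R where R: "degree R \<le> card ?nodes - 1" "\<forall>x\<in>?nodes. poly R x = (if x > of_int j then 1 else 0)"
    using lagrange_interpolation_exists[of ?nodes "\<lambda>x. if x > of_int j then 1 else 0"] by auto
  have "card ?nodes = n + 2" by (subst card_image) (auto simp: inj_on_def)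
  then have "degree (pderiv R) \<le> n" using R(1) by (simp add: degree_pderiv)
  moreover have "unit_average (pderiv R) i = (if i = j then 1 else 0)" if "i \<in> {a..a + int n}" for i
  proof -
    have "of_int i - 1/2 \<in> ?nodes" "of_int i + 1/2 \<in> ?nodes"
      using that by (auto intro!: image_eqI[of _ _ i] image_eqI[of _ _ "i + 1"])
    moreover have "(of_int i + 1/2 > (of_int j :: real)) \<longleftrightarrow> i \<ge> j" 
      "(of_int i - 1/2 > (of_int j :: real)) \<longleftrightarrow> i > j"
      using of_int_le_iff[where 'a = real, of "i + 1" j] of_int_le_iff[where 'a = real, of j i]
        of_int_le_iff[where 'a = real, of "j + 1" i] of_int_le_iff[where 'a = real, of i j]
      by (auto simp del: of_int_le_iff) 
    ultimately show ?thesis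
      using R(2)[rule_format, of "of_int i - 1/2"] R(2)[rule_format, of "of_int i + 1/2"]
      by (simp add: unit_average_pderiv)
  qed
  ultimately have "\<exists>p. degree p \<le> n \<and>
     (\<forall>i\<in>{a..a + int n}. unit_average p i = (if i = j then 1 else 0))" by blast
  from someI_ex[OF this]
  show "degree (cardinal_poly n a j) \<le> n"
    "i \<in> {a..a + int n} \<Longrightarrow> unit_average (cardinal_poly n a j) i = (if i = j then 1 else 0)"
    unfolding cardinal_poly_def by auto
qed

definition recon :: "nat \<Rightarrow> int \<Rightarrow> (int \<Rightarrow> real) \<Rightarrow> real poly" where
  "recon n a v = (\<Sum>j\<in>{a..a + int n}. smult (v j) (cardinal_poly n a j))"

lemma degree_recon: "degree (recon n a v) \<le> n"
  unfolding recon_def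
  by (intro degree_sum_le) (auto intro: order_trans[OF degree_smult_le] cardinal_poly)

lemma unit_average_recon: "j \<in> {a..a + int n} \<Longrightarrow> unit_average (recon n a v) j = v j"
  by (simp add: recon_def unit_average_sum unit_average_smult cardinal_poly if_distrib
      cong: if_cong)

lemma recon_unique:
  assumes "degree p \<le> n" "\<And>j. j \<in> {a..a + int n} \<Longrightarrow> unit_average p j = v j"
  shows "recon n a v = p"
proof -
  have "recon n a v - p = 0"
    using assms
    by (intro zero_of_unit_averages_zero[of _ n a] degree_diff_le degree_recon)
       (auto simp: unit_average_diff unit_average_recon)
  then show ?thesis by simp
qed

lemma recon_poly: "degree p \<le> n \<Longrightarrow> recon n a (unit_average p) = p"
  by (rule recon_unique) auto

lemma recon_add: "recon n a (\<lambda>j. v j + w j) = recon n a v + recon n a w"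
  by (simp add: recon_def smult_add_left sum.distrib)

lemma recon_cmult: "recon n a (\<lambda>j. s * v j) = smult s (recon n a v)"
  by (rule recon_unique)
     (auto intro: order_trans[OF degree_smult_le] degree_recon
       simp: unit_average_smult unit_average_recon)

lemma recon_diff: "recon n a (\<lambda>j. v j - w j) = recon n a v - recon n a w"
  by (simp add: recon_def smult_diff_left sum_subtractf)

lemma recon_sum: "recon n a (\<lambda>j. \<Sum>i\<in>A. f i j) = (\<Sum>i\<in>A. recon n a (f i))"
  unfolding recon_def by (subst sum.swap) (simp add: smult_sum)

text \<open>Identifies the definite description with an explicit expression that is linear in the data.\<close>

lemma interpolant_eq_recon:
  assumes "h > 0"
  shows "interpolant u h n {a..a + int n} = dilate (1 / h) (recon n a (cell_average u h))"
proof -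
  have inv: "dilate h (dilate (1 / h) p) = p" "dilate (1 / h) (dilate h p) = p" for p :: "real poly"
    using assms by (simp_all add: pcompose_assoc[symmetric] pcompose_pCons)
  show ?thesis
    unfolding interpolant_def
  proof (rule the_equality)
    show "degree (dilate (1 / h) (recon n a (cell_average u h))) \<le> n \<and>
      (\<forall>j\<in>{a..a + int n}. integral (cell h j) (poly (dilate (1 / h) (recon n a (cell_average u h))))
         = h * cell_average u h j)"
      using assms order_trans[OF degree_dilate_le degree_recon]
      by (auto simp: integral_cell_poly inv unit_average_recon)
  next
    fix p assume p: "degree p \<le> n \<and> (\<forall>j\<in>{a..a + int n}. integral (cell h j) (poly p) = h * cell_average u h j)"
    have "recon n a (cell_average u h) = dilate h p"
    proof (rule recon_unique)
      show "degree (dilate h p) \<le> n" using p degree_dilate_le order_trans by blast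
      show "unit_average (dilate h p) j = cell_average u h j" if "j \<in> {a..a + int n}" for j
        using p that assms by (auto simp: integral_cell_poly)
    qed
    then show "p = dilate (1 / h) (recon n a (cell_average u h))" by (simp add: inv)
  qed
qed

section \<open>Taylor expansion of cell averages\<close>

lemma C_k_on_mono:
  assumes "C_k_on n u S" "m \<le> n" "open S"
  shows "C_k_on m u S"
proof (cases "m = n")
  case False
  then have "(deriv ^^ m) u field_differentiable (at x)" if "x \<in> S" for x
    using assms that by (simp add: C_k_on_def)
  then have "continuous_on S ((deriv ^^ m) u)"
    by (intro continuous_at_imp_continuous_on ballI field_differentiable_imp_continuous_at)
  then show ?thesis using assms by (simp add: C_k_on_def)
qed (use assms in simp)

lemma C_k_on_imp_continuous_on:
  assumes "C_k_on n u S" "open S"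
  shows "continuous_on S u"
  using C_k_on_mono[OF assms(1) le0 assms(2)] by (simp add: C_k_on_def)

definition taylor_poly :: "nat \<Rightarrow> (real \<Rightarrow> real) \<Rightarrow> real poly" where
  "taylor_poly m u = (\<Sum>i<m. monom ((deriv ^^ i) u 0 / fact i) i)"

lemma degree_taylor_poly: "m \<le> Suc n \<Longrightarrow> degree (taylor_poly m u) \<le> n"
  unfolding taylor_poly_def
  by (intro degree_sum_le) (auto intro: order_trans[OF degree_monom_le])

lemma dilate_monom: "dilate s (monom a i) = smult (a * s ^ i) (monom 1 i)"
  by (rule poly_eqI) (simp add: coeff_pcompose_linear)

lemma dilate_taylor_poly:
  "dilate h (taylor_poly m u) = (\<Sum>i<m. smult ((deriv ^^ i) u 0 / fact i * h ^ i) (monom 1 i))"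
  by (simp add: taylor_poly_def pcompose_sum dilate_monom)

lemma taylor_remainder_bound:
  assumes "C_k_on m u {-\<delta><..<\<delta>}" "\<delta> > 0"
  obtains M where "M \<ge> 0" "\<And>x. \<bar>x\<bar> \<le> \<delta> / 2 \<Longrightarrow> \<bar>u x - poly (taylor_poly m u) x\<bar> \<le> M * \<bar>x\<bar> ^ m"
proof -
  have "continuous_on {-\<delta>/2..\<delta>/2} ((deriv ^^ m) u)"
    using assms by (auto simp: C_k_on_def elim: continuous_on_subset)
  then have "bounded ((deriv ^^ m) u ` {-\<delta>/2..\<delta>/2})"
    by (intro compact_imp_bounded compact_continuous_image) auto
  then obtain B where B: "\<And>x. x \<in> {-\<delta>/2..\<delta>/2} \<Longrightarrow> \<bar>(deriv ^^ m) u x\<bar> \<le> B"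
    unfolding bounded_iff real_norm_def by blast
  have "\<bar>u x - poly (taylor_poly m u) x\<bar> \<le> B / fact m * \<bar>x\<bar> ^ m" if x: "\<bar>x\<bar> \<le> \<delta> / 2" for x
  proof -
    have "\<forall>i t. i < m \<and> \<bar>t\<bar> \<le> \<bar>x\<bar> \<longrightarrow> DERIV ((deriv ^^ i) u) t :> (deriv ^^ Suc i) u t"
    proof (intro allI impI)
      fix i t assume it: "i < m \<and> \<bar>t\<bar> \<le> \<bar>x\<bar>"
      with x assms(2) have "t \<in> {-\<delta><..<\<delta>}" by auto
      with it assms(1) have "(deriv ^^ i) u field_differentiable (at t)" by (simp add: C_k_on_def)
      then show "DERIV ((deriv ^^ i) u) t :> (deriv ^^ Suc i) u t"
        by (simp add: DERIV_deriv_iff_field_differentiable)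
    qed
    from Maclaurin_bi_le[of "\<lambda>i. (deriv ^^ i) u" u, OF _ this]
    obtain t where t: "\<bar>t\<bar> \<le> \<bar>x\<bar>"
      "u x = (\<Sum>i<m. (deriv ^^ i) u 0 / fact i * x ^ i) + (deriv ^^ m) u t / fact m * x ^ m"
      by auto
    then have "\<bar>u x - poly (taylor_poly m u) x\<bar> = \<bar>(deriv ^^ m) u t\<bar> / fact m * \<bar>x\<bar> ^ m"
      by (simp add: taylor_poly_def poly_sum poly_monom abs_mult power_abs)
    also have "\<dots> \<le> B / fact m * \<bar>x\<bar> ^ m"
      using t x by (intro mult_right_mono divide_right_mono B) auto
    finally show ?thesis .
  qed
  moreover have "B \<ge> 0" using B[of 0] assms(2) abs_ge_zero order_trans by fastforce
  ultimately show thesis by (intro that[of "B / fact m"]) auto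
qed

lemma cell_subset:
  assumes "h > 0" "x \<in> cell h j"
  shows "\<bar>x\<bar> \<le> (\<bar>of_int j\<bar> + 1) * h"
proof -
  have "x \<le> (of_int j + 1/2) * h" "(of_int j - 1/2) * h \<le> x"
    using assms by (auto simp: cell_def)
  moreover have "(of_int j + 1/2) * h \<le> (\<bar>of_int j\<bar> + 1) * h"
      "(- of_int j + 1/2) * h \<le> (\<bar>of_int j\<bar> + 1) * h"
    using assms(1) by (intro mult_right_mono; simp)+
  ultimately show ?thesis by (auto simp: abs_le_iff algebra_simps)
qed

text \<open>For the data, a smooth function may be replaced by its Taylor polynomial at the centre of
the stencil: every cell of a fixed index lies within distance \<open>O(h)\<close> of 0.\<close>

lemma cell_average_remainder_bigo:
  assumes "C_k_on m u {-\<delta><..<\<delta>}" "\<delta> > 0"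
  shows "(\<lambda>h. cell_average u h j - unit_average (dilate h (taylor_poly m u)) j) \<in> O[at_right 0](\<lambda>h. h ^ m)"
proof -
  let ?T = "taylor_poly m u"
  define b where "b = \<bar>of_int j\<bar> + (1 :: real)"
  have b: "b > 0" unfolding b_def by linarith
  obtain M where M: "M \<ge> 0" "\<And>x. \<bar>x\<bar> \<le> \<delta> / 2 \<Longrightarrow> \<bar>u x - poly ?T x\<bar> \<le> M * \<bar>x\<bar> ^ m"
    using taylor_remainder_bound[OF assms] by blast
  have "eventually (\<lambda>h. h < \<delta> / 2 / b) (at_right 0)"
    using assms(2) b by (intro eventually_at_rightI[of 0 "\<delta> / 2 / b"]) auto
  then have "eventually (\<lambda>h. norm (cell_average u h j - unit_average (dilate h ?T) j)
      \<le> M * b ^ m * norm (h ^ m)) (at_right 0)"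
    using eventually_at_right_less[of 0]
  proof eventually_elim
    case (elim h)
    have small: "\<bar>x\<bar> \<le> b * h" "\<bar>x\<bar> \<le> \<delta> / 2" if "x \<in> cell h j" for x
    proof -
      show *: "\<bar>x\<bar> \<le> b * h" using cell_subset[OF elim(2) that] by (simp add: b_def)
      have "b * h \<le> \<delta> / 2" using elim(1) b by (simp add: field_simps)
      with * show "\<bar>x\<bar> \<le> \<delta> / 2" by simp
    qed
    have cont: "continuous_on (cell h j) u"
    proof (rule continuous_on_subset)
      show "continuous_on {-\<delta><..<\<delta>} u" using C_k_on_imp_continuous_on[OF assms(1)] by simp
      show "cell h j \<subseteq> {-\<delta><..<\<delta>}" using small(2) assms(2) by fastforce
    qed
    then have int: "u integrable_on cell h j"
      unfolding cell_def by (rule integrable_continuous_interval)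
    have "norm (integral (cell h j) (\<lambda>x. u x - poly ?T x)) \<le> M * (b * h) ^ m *
        ((of_int j + 1/2) * h - (of_int j - 1/2) * h)"
      unfolding cell_def
    proof (rule integral_bound)
      show "(of_int j - 1/2) * h \<le> (of_int j + 1/2) * h"
        using elim(2) by (intro mult_right_mono) auto
      show "continuous_on {(of_int j - 1/2) * h..(of_int j + 1/2) * h} (\<lambda>x. u x - poly ?T x)"
        using cont by (auto simp: cell_def intro!: continuous_intros)
      show "norm (u x - poly ?T x) \<le> M * (b * h) ^ m"
        if "x \<in> {(of_int j - 1/2) * h..(of_int j + 1/2) * h}" for x
      proof -
        have x: "x \<in> cell h j" using that by (simp add: cell_def)
        have "norm (u x - poly ?T x) \<le> M * \<bar>x\<bar> ^ m" using M(2) small(2)[OF x] by simp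
        also have "\<dots> \<le> M * (b * h) ^ m"
          using M(1) small(1)[OF x] by (intro mult_left_mono power_mono) auto
        finally show ?thesis .
      qed
    qed
    also have "(of_int j + 1/2) * h - (of_int j - 1/2) * h = h" by (simp add: algebra_simps)
    also have "integral (cell h j) (\<lambda>x. u x - poly ?T x)
        = h * (cell_average u h j - unit_average (dilate h ?T) j)"
      using integral_diff[OF int integrable_poly_cell[of ?T h j]] elim(2)
      by (simp add: cell_average_def integral_cell_poly right_diff_distrib)
    finally have "h * \<bar>cell_average u h j - unit_average (dilate h ?T) j\<bar> \<le> h * (M * b ^ m * h ^ m)"
      using elim(2) by (simp add: abs_mult power_mult_distrib mult_ac)
    then show ?case using elim(2) by simp
  qed
  then show ?thesis by (rule bigoI)
qed

lemma bigo_at_right_powerD: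
  fixes f :: "real \<Rightarrow> real"
  assumes "f \<in> O[at_right 0](\<lambda>h. h ^ m)"
  obtains K where "K > 0" "\<forall>\<^sub>F h in at_right 0. \<bar>f h\<bar> \<le> K * h ^ m"
proof -
  obtain K where K: "K > 0" "\<forall>\<^sub>F h in at_right 0. norm (f h) \<le> K * norm (h ^ m)"
    using landau_o.bigE[OF assms] by blast
  from K(2) eventually_at_right_less[of 0]
  have "\<forall>\<^sub>F h in at_right 0. \<bar>f h\<bar> \<le> K * h ^ m"
    by eventually_elim simp
  with K(1) show thesis by (rule that)
qed

lemma bigo_at_right_power_mono:
  assumes "f \<in> O[at_right 0](\<lambda>h :: real. h ^ m)" "k \<le> m"
  shows "f \<in> O[at_right 0](\<lambda>h :: real. h ^ k)"
proof -
  have "eventually (\<lambda>h::real. h < 1) (at_right 0)"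
    by (intro eventually_at_rightI[of 0 1]) auto
  then have "eventually (\<lambda>h::real. norm (h ^ m) \<le> 1 * norm (h ^ k)) (at_right 0)"
    using eventually_at_right_less[of 0]
    by eventually_elim (use assms(2) in \<open>simp add: power_decreasing\<close>)
  then have "(\<lambda>h::real. h ^ m) \<in> O[at_right 0](\<lambda>h. h ^ k)" by (rule bigoI)
  with assms(1) show ?thesis by (rule landau_o.big_trans)
qed

section \<open>Order of approximation of interpolants\<close>

definition approximates :: "nat \<Rightarrow> (real \<Rightarrow> real poly) \<Rightarrow> (real \<Rightarrow> real) \<Rightarrow> bool" where
  "approximates m P u \<longleftrightarrow>
     (\<exists>K. \<forall>\<^sub>F h in at_right 0. \<forall>x\<in>cell h 0. \<bar>poly (P h) x - u x\<bar> \<le> K * h ^ m)"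

text \<open>The Taylor polynomial of degree \<open>n\<close> is reproduced exactly. What is left is the reconstruction
from averages of size \<open>O(h^(n+1))\<close>, evaluated at \<open>x / h\<close>, which stays in \<open>[-1/2, 1/2]\<close>; there the
dual basis is bounded by constants that do not depend on \<open>h\<close>.\<close>

lemma approximates_interpolant:
  assumes "C_k_on (Suc n) u {-\<delta><..<\<delta>}" "\<delta> > 0"
  shows "approximates (Suc n) (\<lambda>h. interpolant u h n {a..a + int n}) u"
proof -
  let ?T = "taylor_poly (Suc n) u"
  let ?J = "{a..a + int n}"
  define e where "e h j = cell_average u h j - unit_average (dilate h ?T) j" for h j
  have "\<exists>B. \<forall>y\<in>{-1/2..1/2}. \<bar>poly (cardinal_poly n a j) y\<bar> \<le> B" for j
  proof -
    have "bounded (poly (cardinal_poly n a j) ` {-1/2..1/2})"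
      by (intro compact_imp_bounded compact_continuous_image continuous_intros) auto
    then show ?thesis by (auto simp: bounded_iff)
  qed
  then obtain B where B: "\<And>j y. y \<in> {-1/2..1/2} \<Longrightarrow> \<bar>poly (cardinal_poly n a j) y\<bar> \<le> B j"
    by metis
  have "(\<lambda>h. \<bar>e h j\<bar> * B j) \<in> O[at_right 0](\<lambda>h. h ^ Suc n)" for j
    using cell_average_remainder_bigo[OF assms, of j] unfolding e_def
    by (cases "B j = 0") auto
  then have bigo: "(\<lambda>h. \<Sum>j\<in>?J. \<bar>e h j\<bar> * B j) \<in> O[at_right 0](\<lambda>h. h ^ Suc n)"
    by (intro big_sum_in_bigo)
  obtain M where M: "M \<ge> 0"
      "\<And>x. \<bar>x\<bar> \<le> \<delta> / 2 \<Longrightarrow> \<bar>u x - poly ?T x\<bar> \<le> M * \<bar>x\<bar> ^ Suc n"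
    using taylor_remainder_bound[OF assms] by blast
  from bigo obtain K1 where "\<forall>\<^sub>F h in at_right 0. \<bar>\<Sum>j\<in>?J. \<bar>e h j\<bar> * B j\<bar> \<le> K1 * h ^ Suc n"
    using bigo_at_right_powerD by blast
  moreover have "\<forall>\<^sub>F h in at_right 0. h < \<delta> / 2"
    using assms(2) by (intro eventually_at_rightI[of 0 "\<delta> / 2"]) auto
  ultimately have "\<forall>\<^sub>F h in at_right 0. \<forall>x\<in>cell h 0.
      \<bar>poly (interpolant u h n ?J) x - u x\<bar> \<le> (K1 + M) * h ^ Suc n"
    using eventually_at_right_less[of 0]
  proof eventually_elim
    case (elim h)
    show ?case
    proof
      fix x assume x: "x \<in> cell h 0"
      have y: "x / h \<in> {-1/2..1/2}"
        using x elim(3) by (auto simp: cell_def field_simps)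
      have absx: "\<bar>x\<bar> \<le> h" using cell_subset[OF elim(3) x] by simp
      have "recon n a (cell_average u h) = recon n a (\<lambda>j. unit_average (dilate h ?T) j + e h j)"
        by (simp add: e_def)
      also have "\<dots> = dilate h ?T + recon n a (e h)"
      proof -
        have "degree (dilate h ?T) \<le> n"
          using degree_taylor_poly[of "Suc n" n u] degree_dilate_le order_trans by blast
        then show ?thesis by (simp add: recon_add recon_poly)
      qed
      finally have "poly (interpolant u h n ?J) x = poly ?T x + (\<Sum>j\<in>?J. e h j * poly (cardinal_poly n a j) (x / h))"
        using elim(3) by (simp add: interpolant_eq_recon poly_pcompose recon_def poly_sum)
      moreover have "\<bar>\<Sum>j\<in>?J. e h j * poly (cardinal_poly n a j) (x / h)\<bar> \<le> (\<Sum>j\<in>?J. \<bar>e h j\<bar> * B j)"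
        using B[OF y] by (intro order_trans[OF sum_abs] sum_mono) (simp add: abs_mult mult_left_mono)
      moreover have "(\<Sum>j\<in>?J. \<bar>e h j\<bar> * B j) \<le> K1 * h ^ Suc n" using elim(1) by linarith
      moreover have "\<bar>u x - poly ?T x\<bar> \<le> M * h ^ Suc n"
      proof -
        have "\<bar>u x - poly ?T x\<bar> \<le> M * \<bar>x\<bar> ^ Suc n" using absx elim(2) by (intro M(2)) simp
        also have "\<dots> \<le> M * h ^ Suc n"
          using absx M(1) by (intro mult_left_mono power_mono) auto
        finally show ?thesis .
      qed
      ultimately show "\<bar>poly (interpolant u h n ?J) x - u x\<bar> \<le> (K1 + M) * h ^ Suc n"
        unfolding distrib_right by linarith
    qed
  qed
  then show ?thesis unfolding approximates_def by blast
qed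

section \<open>The Jiang--Shu form\<close>

text \<open>The symmetric bilinear form whose quadratic form is the smoothness indicator in the variable
\<open>x / h\<close>. The number of terms is a parameter, so that the form is bilinear across polynomials
of different degrees.\<close>

definition jiang_shu :: "nat \<Rightarrow> real poly \<Rightarrow> real poly \<Rightarrow> real" where
  "jiang_shu N p q = (\<Sum>l = 1..N. unit_average ((pderiv ^^ l) p * (pderiv ^^ l) q) 0)"

lemma jiang_shu_commute: "jiang_shu N p q = jiang_shu N q p"
  by (simp add: jiang_shu_def mult.commute)

lemma jiang_shu_add_right: "jiang_shu N p (q + q') = jiang_shu N p q + jiang_shu N p q'"
  by (simp add: jiang_shu_def higher_pderiv_add distrib_left unit_average_add sum.distrib)

lemma jiang_shu_smult_right: "jiang_shu N p (smult a q) = a * jiang_shu N p q"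
  by (simp add: jiang_shu_def higher_pderiv_smult unit_average_smult sum_distrib_left)

lemma jiang_shu_sum_right: "jiang_shu N p (\<Sum>i\<in>A. f i) = (\<Sum>i\<in>A. jiang_shu N p (f i))"
proof (induction A rule: infinite_finite_induct)
  case (insert x A)
  then show ?case by (simp add: jiang_shu_add_right)
qed (use jiang_shu_smult_right[of N p 0 0] in simp_all)

lemma jiang_shu_diff_right: "jiang_shu N p (q - q') = jiang_shu N p q - jiang_shu N p q'"
  using jiang_shu_add_right[of N p q "smult (-1) q'"] jiang_shu_smult_right[of N p "-1" q'] by simp

lemma jiang_shu_square_diff:
  "jiang_shu N (q - p) (q - p) = jiang_shu N q q - 2 * jiang_shu N p q + jiang_shu N p p"
  using jiang_shu_diff_right[of N "q - p" q p] jiang_shu_diff_right[of N q q p]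
    jiang_shu_diff_right[of N p q p] jiang_shu_commute[of N "q - p" q]
    jiang_shu_commute[of N "q - p" p] jiang_shu_commute[of N q p]
  by linarith

lemma higher_pderiv_dilate:
  "(pderiv ^^ l) (dilate s p) = smult (s ^ l) (dilate s ((pderiv ^^ l) p))"
  by (induction l) (simp_all add: pderiv_smult pderiv_pcompose pderiv_pCons mult.commute)

lemma higher_pderiv_eq_0: "degree p < l \<Longrightarrow> (pderiv ^^ l) (p :: real poly) = 0"
  by (rule poly_eqI) (simp add: coeff_higher_pderiv coeff_eq_0)

text \<open>The powers of \<open>h\<close> in the indicator are chosen so that it is invariant under rescaling: each
derivative contributes \<open>1 / h\<close>, squared, and the integral contributes one factor \<open>h\<close>.\<close>

lemma smoothness_dilate:
  assumes "h > 0" "degree Q \<le> N"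
  shows "smoothness h (dilate (1 / h) Q) = jiang_shu N Q Q"
proof -
  have deg: "degree (dilate (1 / h) Q) = degree Q"
    using assms(1) by (simp add: degree_pcompose)
  have inv: "dilate h (dilate (1 / h) p) = p" for p :: "real poly"
    using assms by (simp add: pcompose_assoc[symmetric] pcompose_pCons)
  have "h ^ (2 * l - 1) * integral (cell h 0) (\<lambda>x. (poly ((pderiv ^^ l) (dilate (1 / h) Q)) x)\<^sup>2)
      = unit_average ((pderiv ^^ l) Q * (pderiv ^^ l) Q) 0" if "l \<in> {1..N}" for l
  proof -
    let ?D = "(pderiv ^^ l) Q * (pderiv ^^ l) Q"
    have "(\<lambda>x. (poly ((pderiv ^^ l) (dilate (1 / h) Q)) x)\<^sup>2)
        = poly (smult ((1 / h) ^ (2 * l)) (dilate (1 / h) ?D))"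
      by (rule ext)
         (simp add: higher_pderiv_dilate poly_pcompose power_even_eq power2_eq_square)
    then have "integral (cell h 0) (\<lambda>x. (poly ((pderiv ^^ l) (dilate (1 / h) Q)) x)\<^sup>2)
        = h * ((1 / h) ^ (2 * l) * unit_average ?D 0)"
      using assms(1) by (simp only: integral_cell_poly pcompose_smult inv unit_average_smult)
    moreover have "h ^ (2 * l - 1) * (h * (1 / h) ^ (2 * l)) = 1"
    proof -
      have "h ^ (2 * l - 1) * h = h ^ (2 * l)" using that by (simp add: power_eq_if)
      then show ?thesis using assms(1) by (simp add: power_one_over flip: mult.assoc)
    qed
    ultimately show ?thesis by (simp add: mult.assoc[symmetric])
  qed
  then have "smoothness h (dilate (1 / h) Q)
      = (\<Sum>l = 1..degree Q. unit_average ((pderiv ^^ l) Q * (pderiv ^^ l) Q) 0)"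
    unfolding smoothness_def deg using assms(2) by (intro sum.cong refl) auto
  also have "(\<Sum>l = 1..degree Q. unit_average ((pderiv ^^ l) Q * (pderiv ^^ l) Q) 0) = jiang_shu N Q Q"
    unfolding jiang_shu_def using assms(2)
    by (intro sum.mono_neutral_left) (auto simp: higher_pderiv_eq_0[of Q])
  finally show ?thesis .
qed

lemma smoothness_nonneg:
  assumes "h > 0"
  shows "smoothness h P \<ge> 0"
  unfolding smoothness_def
proof (intro sum_nonneg mult_nonneg_nonneg)
  fix l
  have "(\<lambda>x. (poly ((pderiv ^^ l) P) x)\<^sup>2) integrable_on cell h 0"
    unfolding cell_def by (intro integrable_continuous_interval continuous_intros)
  then show "integral (cell h 0) (\<lambda>x. (poly ((pderiv ^^ l) P) x)\<^sup>2) \<ge> 0"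
    by (intro integral_nonneg) auto
qed (use assms in auto)

lemma higher_pderiv_monom_low: "n < l \<Longrightarrow> (pderiv ^^ l) (monom (a :: real) n) = 0"
  by (rule higher_pderiv_eq_0) (rule le_less_trans[OF degree_monom_le])

lemma jiang_shu_const: "jiang_shu N (monom a 0) q = 0"
  unfolding jiang_shu_def by (intro sum.neutral) (simp add: higher_pderiv_monom_low)

text \<open>Only the first derivative of \<open>y\<close> survives, so the form integrates \<open>p'\<close>.\<close>

lemma jiang_shu_linear:
  assumes "N \<ge> 1"
  shows "jiang_shu N (monom 1 1) p = poly p (1/2) - poly p (-1/2)"
proof -
  have "jiang_shu N (monom 1 1) p = (\<Sum>l\<in>{1}. unit_average ((pderiv ^^ l) (monom 1 1) * (pderiv ^^ l) p) 0)"
    unfolding jiang_shu_def using assms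
    by (intro sum.mono_neutral_right) (auto simp: higher_pderiv_monom_low)
  also have "\<dots> = unit_average (pderiv p) 0"
  proof -
    have "pderiv (monom 1 1) = (1 :: real poly)" by (simp add: pderiv_monom)
    then show ?thesis by simp
  qed
  finally show ?thesis by (simp add: unit_average_pderiv)
qed

lemma jiang_shu_reflect: "jiang_shu N (dilate (-1) p) (dilate (-1) q) = jiang_shu N p q"
proof -
  have "(pderiv ^^ l) (dilate (-1) p) * (pderiv ^^ l) (dilate (-1) q)
      = dilate (-1) ((pderiv ^^ l) p * (pderiv ^^ l) q)" for l
    by (simp add: higher_pderiv_dilate pcompose_mult flip: power_mult_distrib)
  then show ?thesis by (simp only: jiang_shu_def unit_average_reflect minus_zero)
qed

lemma recon_reflect:
  "recon n (- a - int n) (\<lambda>j. v (- j)) = dilate (-1) (recon n a v)"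
  by (rule recon_unique)
     (auto intro: order_trans[OF degree_dilate_le] degree_recon
       simp: unit_average_reflect unit_average_recon)

lemma jiang_shu_recon:
  "jiang_shu N p (recon n a v) = (\<Sum>j\<in>{a..a + int n}. v j * jiang_shu N p (cardinal_poly n a j))"
  by (simp add: recon_def jiang_shu_sum_right jiang_shu_smult_right)

lemma cmult_bigo: "f \<in> O[F](g) \<Longrightarrow> (\<lambda>x. a * f x :: real) \<in> O[F](g)"
  by (cases "a = 0") auto

lemma jiang_shu_recon_bigo:
  fixes e :: "real \<Rightarrow> int \<Rightarrow> real"
  assumes "\<And>j. (\<lambda>h. e h j) \<in> O[F](g)"
  shows "(\<lambda>h. jiang_shu N p (recon n a (e h))) \<in> O[F](g)"
  unfolding jiang_shu_recon
proof (rule big_sum_in_bigo)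
  show "(\<lambda>h. e h j * jiang_shu N p (cardinal_poly n a j)) \<in> O[F](g)" for j
    using assms[of j] by (cases "jiang_shu N p (cardinal_poly n a j) = 0") auto
qed

lemma jiang_shu_recon_square_bigo:
  fixes e :: "real \<Rightarrow> int \<Rightarrow> real"
  assumes "\<And>j. (\<lambda>h. e h j) \<in> O[F](g)"
  shows "(\<lambda>h. jiang_shu N (recon n a (e h)) (recon n a (e h))) \<in> O[F](\<lambda>h. g h * g h)"
proof -
  have "(\<lambda>h. \<Sum>j\<in>{a..a + int n}. e h j * jiang_shu N (cardinal_poly n a j) (recon n a (e h)))
      \<in> O[F](\<lambda>h. g h * g h)"
    by (intro big_sum_in_bigo landau_o.big.mult assms jiang_shu_recon_bigo)
  then show ?thesis
    by (subst jiang_shu_recon) (simp only: jiang_shu_commute[of N "recon n a _"])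
qed

section \<open>The order of the global smoothness indicator\<close>

abbreviation sub_recon :: "nat \<Rightarrow> nat \<Rightarrow> (int \<Rightarrow> real) \<Rightarrow> real poly" where
  "sub_recon r k v \<equiv> recon (r - 1) (int k - int r) v"

lemma P_sub_eq_interpolant:
  assumes "r \<ge> 1"
  shows "P_sub u h r k = interpolant u h (r - 1) {int k - int r..int k - int r + int (r - 1)}"
proof -
  have "- int r + int k = int k - int r" "int k - 1 = int k - int r + int (r - 1)"
    using assms by (auto simp: of_nat_diff)
  then show ?thesis by (simp only: P_sub_def)
qed

lemma tau_eq:
  assumes "r \<ge> 1" "h > 0"
  shows "tau u h r c = \<bar>\<Sum>k = 1..r. c ! (k - 1) *
    jiang_shu (r - 1) (sub_recon r k (cell_average u h)) (sub_recon r k (cell_average u h))\<bar>"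
  unfolding tau_def
  using assms by (simp only: P_sub_eq_interpolant interpolant_eq_recon smoothness_dilate[OF _ degree_recon])

text \<open>The pairing of \<open>y^i\<close> with the reconstructions of \<open>y^j\<close> multiplies \<open>h^(i+j)\<close> in the expansion of
the global smoothness indicator, so vanishing moments raise its order.\<close>

definition moment :: "nat \<Rightarrow> real list \<Rightarrow> nat \<Rightarrow> nat \<Rightarrow> real" where
  "moment r c i j = (\<Sum>k = 1..r. c ! (k - 1) *
     jiang_shu (r - 1) (monom 1 i) (sub_recon r k (unit_average (monom 1 j))))"

text \<open>A linear functional of the cell averages that annihilates those of all monomials of degree
less than \<open>m\<close> is \<open>O(h^m)\<close> on smooth data. Here the functional is
\<open>v \<mapsto> \<Sum>\<^sub>k c\<^sub>k \<langle>y^i, L\<^sub>k v\<rangle>\<close>.\<close>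

lemma weighted_recon_bigo:
  assumes "C_k_on m u {-\<delta><..<\<delta>}" "\<delta> > 0" and moments: "\<And>j. j < m \<Longrightarrow> moment r c i j = 0"
  shows "(\<lambda>h. \<Sum>k = 1..r. c ! (k - 1) *
      jiang_shu (r - 1) (monom 1 i) (sub_recon r k (cell_average u h))) \<in> O[at_right 0](\<lambda>h. h ^ m)"
proof -
  let ?T = "taylor_poly m u"
  let ?J = "jiang_shu (r - 1) (monom 1 i)"
  define e where "e h j = cell_average u h j - unit_average (dilate h ?T) j" for h j
  define a where "a l = (deriv ^^ l) u 0 / fact l" for l
  have e: "(\<lambda>h. e h j) \<in> O[at_right 0](\<lambda>h. h ^ m)" for j
    unfolding e_def using cell_average_remainder_bigo[OF assms(1,2)] .
  have taylor: "unit_average (dilate h ?T) = (\<lambda>j. \<Sum>l<m. a l * h ^ l * unit_average (monom 1 l) j)" for h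
    by (rule ext) (simp add: dilate_taylor_poly unit_average_sum unit_average_smult a_def)
  have "(\<Sum>k = 1..r. c ! (k - 1) * ?J (sub_recon r k (unit_average (dilate h ?T)))) = 0" for h
  proof -
    have "(\<Sum>k = 1..r. c ! (k - 1) * ?J (sub_recon r k (unit_average (dilate h ?T))))
        = (\<Sum>k = 1..r. \<Sum>l<m. a l * h ^ l * (c ! (k - 1) * ?J (sub_recon r k (unit_average (monom 1 l)))))"
      by (simp add: taylor recon_sum recon_cmult jiang_shu_sum_right jiang_shu_smult_right
          sum_distrib_left algebra_simps)
    also have "\<dots> = (\<Sum>l<m. a l * h ^ l * moment r c i l)"
      by (subst sum.swap) (simp add: moment_def sum_distrib_left)
    finally show ?thesis using moments by simp
  qed
  moreover have "cell_average u h = (\<lambda>j. unit_average (dilate h ?T) j + e h j)" for h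
    by (simp add: e_def)
  ultimately have "(\<Sum>k = 1..r. c ! (k - 1) * ?J (sub_recon r k (cell_average u h)))
      = (\<Sum>k = 1..r. c ! (k - 1) * ?J (sub_recon r k (e h)))" for h
    by (simp add: recon_add jiang_shu_add_right distrib_left sum.distrib)
  moreover have "(\<lambda>h. \<Sum>k = 1..r. c ! (k - 1) * ?J (sub_recon r k (e h))) \<in> O[at_right 0](\<lambda>h. h ^ m)"
  proof (rule big_sum_in_bigo)
    show "(\<lambda>h. c ! (k - 1) * ?J (sub_recon r k (e h))) \<in> O[at_right 0](\<lambda>h. h ^ m)" for k
      using jiang_shu_recon_bigo[OF e] by (cases "c ! (k - 1) = 0") auto
  qed
  ultimately show ?thesis by simp
qed

text \<open>Let \<open>A\<close> be the rescaled Taylor polynomial of degree \<open>r - 1\<close>, so that \<open>L\<^sub>k\<close> reproduces it, and let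
\<open>e\<close> be the remaining data of size \<open>O(h^r)\<close>. The quadratic form at \<open>q\<^sub>k = A + L\<^sub>k e\<close> is written as
\<open>2 \<langle>A, q\<^sub>k\<rangle> - \<langle>A, A\<rangle> + \<langle>L\<^sub>k e, L\<^sub>k e\<rangle>\<close>, with \<open>q\<^sub>k\<close> and not \<open>L\<^sub>k e\<close> in the mixed term: the latter then
consists of functionals of the full cell averages of \<open>u\<close>, and \<open>weighted_recon_bigo\<close> applies to
the one paired with \<open>y^i\<close> at its own order \<open>\<theta> - i\<close>, the factor \<open>h^i\<close> coming from \<open>A\<close>. The last term
is \<open>O(h^(2r))\<close>, whence the bound on \<open>\<theta>\<close>.\<close>

lemma tau_bigo:
  assumes "r \<ge> 1" "\<theta> \<le> 2 * r"
    and smooth: "C_k_on (2 * r - 1) u {-\<delta><..<\<delta>}" "\<delta> > 0"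
    and csum: "(\<Sum>k = 1..r. c ! (k - 1)) = 0"
    and moments: "\<And>i j. 1 \<le> i \<Longrightarrow> i < r \<Longrightarrow> i + j < \<theta> \<Longrightarrow> moment r c i j = 0"
  shows "(\<lambda>h. tau u h r c) \<in> O[at_right 0](\<lambda>h. h ^ \<theta>)"
proof -
  let ?T = "taylor_poly r u"
  let ?J = "jiang_shu (r - 1)"
  let ?Q = "\<lambda>h k. sub_recon r k (cell_average u h)"
  define e where "e h j = cell_average u h j - unit_average (dilate h ?T) j" for h j
  define a where "a l = (deriv ^^ l) u 0 / fact l" for l
  define G where "G h i = (\<Sum>k = 1..r. c ! (k - 1) * ?J (monom 1 i) (?Q h k))" for h i
  have e: "(\<lambda>h. e h j) \<in> O[at_right 0](\<lambda>h. h ^ r)" for j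
  proof -
    have "r \<le> 2 * r - 1" using assms(1) by linarith
    then show ?thesis
      unfolding e_def
      by (intro cell_average_remainder_bigo[OF C_k_on_mono[OF smooth(1)] smooth(2)]) auto
  qed
  \<comment> \<open>The identity \<open>\<langle>q, q\<rangle> = 2 \<langle>A, q\<rangle> - \<langle>A, A\<rangle> + \<langle>q - A, q - A\<rangle>\<close>.\<close>
  have split: "?J (?Q h k) (?Q h k) = 2 * ?J (dilate h ?T) (?Q h k) - ?J (dilate h ?T) (dilate h ?T)
      + ?J (sub_recon r k (e h)) (sub_recon r k (e h))" for h k
  proof -
    have "degree (dilate h ?T) \<le> r - 1"
      using degree_taylor_poly[of r "r - 1" u] degree_dilate_le[of ?T h] assms(1) by simp
    then have "sub_recon r k (e h) = ?Q h k - dilate h ?T"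
      by (simp add: e_def[abs_def] recon_diff recon_poly)
    then show ?thesis
      using jiang_shu_square_diff[of "r - 1" "?Q h k" "dilate h ?T"] by simp
  qed
  have G: "(\<Sum>k = 1..r. c ! (k - 1) * ?J (dilate h ?T) (?Q h k)) = (\<Sum>i<r. a i * h ^ i * G h i)" for h
  proof -
    have "?J (dilate h ?T) q = (\<Sum>i<r. a i * h ^ i * ?J (monom 1 i) q)" for q
    proof -
      have "?J (dilate h ?T) q = ?J q (dilate h ?T)" by (rule jiang_shu_commute)
      also have "\<dots> = (\<Sum>i<r. a i * h ^ i * ?J q (monom 1 i))"
        by (simp only: dilate_taylor_poly jiang_shu_sum_right jiang_shu_smult_right a_def)
      finally show ?thesis by (simp only: jiang_shu_commute[of _ q])
    qed
    then have "(\<Sum>k = 1..r. c ! (k - 1) * ?J (dilate h ?T) (?Q h k))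
        = (\<Sum>k = 1..r. \<Sum>i<r. a i * h ^ i * (c ! (k - 1) * ?J (monom 1 i) (?Q h k)))"
      by (simp only: sum_distrib_left mult.left_commute)
    also have "\<dots> = (\<Sum>i<r. a i * h ^ i * G h i)"
      by (subst sum.swap) (simp add: G_def sum_distrib_left)
    finally show ?thesis .
  qed
  have eq: "(\<Sum>k = 1..r. c ! (k - 1) * ?J (?Q h k) (?Q h k)) = 2 * (\<Sum>i<r. a i * h ^ i * G h i)
      + (\<Sum>k = 1..r. c ! (k - 1) * ?J (sub_recon r k (e h)) (sub_recon r k (e h)))" for h
  proof -
    have "(\<Sum>k = 1..r. c ! (k - 1) * ?J (?Q h k) (?Q h k))
        = (\<Sum>k = 1..r. 2 * (c ! (k - 1) * ?J (dilate h ?T) (?Q h k))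
            - c ! (k - 1) * ?J (dilate h ?T) (dilate h ?T)
            + c ! (k - 1) * ?J (sub_recon r k (e h)) (sub_recon r k (e h)))"
    proof (rule sum.cong[OF refl])
      have ring: "s * (2 * x - y + z) = 2 * (s * x) - s * y + s * z" for s x y z :: real
        by (simp add: algebra_simps)
      fix k
      show "c ! (k - 1) * ?J (?Q h k) (?Q h k) = 2 * (c ! (k - 1) * ?J (dilate h ?T) (?Q h k))
          - c ! (k - 1) * ?J (dilate h ?T) (dilate h ?T)
          + c ! (k - 1) * ?J (sub_recon r k (e h)) (sub_recon r k (e h))"
        unfolding split by (rule ring)
    qed
    also have "\<dots> = 2 * (\<Sum>k = 1..r. c ! (k - 1) * ?J (dilate h ?T) (?Q h k))
        - (\<Sum>k = 1..r. c ! (k - 1)) * ?J (dilate h ?T) (dilate h ?T)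
        + (\<Sum>k = 1..r. c ! (k - 1) * ?J (sub_recon r k (e h)) (sub_recon r k (e h)))"
      by (simp only: sum.distrib sum_subtractf sum_distrib_left sum_distrib_right)
    finally show ?thesis unfolding csum G by simp
  qed
  have "(\<lambda>h. a i * h ^ i * G h i) \<in> O[at_right 0](\<lambda>h. h ^ \<theta>)" if "i < r" for i
  proof (cases "i = 0")
    case True
    then have "G h i = 0" for h
      by (simp only: G_def jiang_shu_const mult_zero_right sum.neutral_const)
    then show ?thesis by simp
  next
    case False
    have "(\<lambda>h. G h i) \<in> O[at_right 0](\<lambda>h. h ^ (\<theta> - i))"
      unfolding G_def using that False assms(2)
      by (intro weighted_recon_bigo[OF C_k_on_mono[OF smooth(1)] smooth(2)] moments) auto
    then have "(\<lambda>h. h ^ i * G h i) \<in> O[at_right 0](\<lambda>h. h ^ (i + (\<theta> - i)))"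
      unfolding power_add by (intro landau_o.big.mult landau_o.big_refl)
    then have "(\<lambda>h. h ^ i * G h i) \<in> O[at_right 0](\<lambda>h. h ^ \<theta>)"
      by (rule bigo_at_right_power_mono) simp
    then show ?thesis unfolding mult.assoc by (rule cmult_bigo)
  qed
  then have first: "(\<lambda>h. \<Sum>i<r. a i * h ^ i * G h i) \<in> O[at_right 0](\<lambda>h. h ^ \<theta>)"
    by (intro big_sum_in_bigo) simp
  have "(\<lambda>h. ?J (sub_recon r k (e h)) (sub_recon r k (e h))) \<in> O[at_right 0](\<lambda>h. h ^ (r + r))" for k
    unfolding power_add by (rule jiang_shu_recon_square_bigo[OF e])
  then have "(\<lambda>h. ?J (sub_recon r k (e h)) (sub_recon r k (e h))) \<in> O[at_right 0](\<lambda>h. h ^ \<theta>)" for k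
    by (rule bigo_at_right_power_mono) (use assms(2) in simp)
  then have second: "(\<lambda>h. \<Sum>k = 1..r. c ! (k - 1) * ?J (sub_recon r k (e h)) (sub_recon r k (e h)))
      \<in> O[at_right 0](\<lambda>h. h ^ \<theta>)"
    by (intro big_sum_in_bigo cmult_bigo)
  have "(\<lambda>h. \<Sum>k = 1..r. c ! (k - 1) * ?J (?Q h k) (?Q h k)) \<in> O[at_right 0](\<lambda>h. h ^ \<theta>)"
    unfolding eq by (rule sum_in_bigo(1)[OF cmult_bigo[OF first] second])
  then have big: "(\<lambda>h. \<bar>\<Sum>k = 1..r. c ! (k - 1) * ?J (?Q h k) (?Q h k)\<bar>) \<in> O[at_right 0](\<lambda>h. h ^ \<theta>)"
    by (simp only: landau_o.big.abs_in_iff)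
  have ev: "\<forall>\<^sub>F h in at_right 0. tau u h r c = \<bar>\<Sum>k = 1..r. c ! (k - 1) * ?J (?Q h k) (?Q h k)\<bar>"
    using eventually_at_right_less[of 0] by (rule eventually_mono) (rule tau_eq[OF assms(1)])
  show ?thesis by (rule iffD2[OF landau_o.big.in_cong[OF ev] big])
qed

section \<open>Vanishing moments\<close>

text \<open>Every substencil reproduces the monomial, so the same number is summed with weights \<open>c\<^sub>k\<close>.\<close>

lemma moment_low_degree:
  assumes "r \<ge> 1" "(\<Sum>k = 1..r. c ! (k - 1)) = 0" "j < r"
  shows "moment r c i j = 0"
proof -
  have "degree (monom (1 :: real) j) \<le> r - 1"
    using assms by (intro order_trans[OF degree_monom_le]) auto
  then have "moment r c i j = (\<Sum>k = 1..r. c ! (k - 1)) * jiang_shu (r - 1) (monom 1 i) (monom 1 j)"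
    by (simp add: moment_def recon_poly sum_distrib_right)
  then show ?thesis using assms(2) by simp
qed

text \<open>The reflection \<open>y \<mapsto> -y\<close> preserves the form, exchanges the substencils \<open>k\<close> and \<open>r + 1 - k\<close>, and
multiplies \<open>y^i\<close> and \<open>y^j\<close> by signs. If the sign on the right is -1 the moment vanishes.\<close>

lemma moment_reflect:
  assumes "r \<ge> 1" and sym: "\<And>k. k \<in> {1..r} \<Longrightarrow> c ! (r - k) = \<sigma> * c ! (k - 1)"
  shows "moment r c i j = \<sigma> * (-1) ^ (i + j) * moment r c i j"
proof -
  let ?v = "unit_average (monom 1 j)"
  let ?J = "jiang_shu (r - 1)"
  have v: "?v l = (-1) ^ j * ?v (- l)" for l
  proof -
    have "?v (- l) = (-1) ^ j * ?v l"
      using unit_average_reflect[of "monom 1 j" l] by (simp add: dilate_monom unit_average_smult)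
    then show ?thesis by simp
  qed
  have mirror: "?J (monom 1 i) (sub_recon r (r + 1 - k) ?v)
      = (-1) ^ (i + j) * ?J (monom 1 i) (sub_recon r k ?v)" if "k \<in> {1..r}" for k
  proof -
    have a: "int (r + 1 - k) - int r = - (int k - int r) - int (r - 1)"
      using that by (auto simp: of_nat_diff)
    have "sub_recon r (r + 1 - k) ?v
        = recon (r - 1) (- (int k - int r) - int (r - 1)) (\<lambda>l. (-1) ^ j * ?v (- l))"
      unfolding a by (rule arg_cong[where f = "recon _ _"], rule ext, rule v)
    also have "\<dots> = smult ((-1) ^ j) (dilate (-1) (sub_recon r k ?v))"
      by (simp only: recon_cmult recon_reflect)
    finally have "?J (monom 1 i) (sub_recon r (r + 1 - k) ?v)
        = (-1) ^ j * ?J (monom 1 i) (dilate (-1) (sub_recon r k ?v))"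
      by (simp only: jiang_shu_smult_right)
    moreover have "?J (monom 1 i) (dilate (-1) q) = (-1) ^ i * ?J (monom 1 i) q" for q
    proof -
      have "?J (monom 1 i) q = ?J (smult ((-1) ^ i) (monom 1 i)) (dilate (-1) q)"
        using jiang_shu_reflect[of "r - 1" "monom 1 i" q] by (simp add: dilate_monom)
      also have "\<dots> = (-1) ^ i * ?J (monom 1 i) (dilate (-1) q)"
        using jiang_shu_smult_right[of "r - 1" "dilate (-1) q" "(-1) ^ i" "monom 1 i"]
        by (simp only: jiang_shu_commute[of _ "dilate (-1) q"])
      finally show ?thesis by simp
    qed
    ultimately show ?thesis by (simp add: power_add)
  qed
  have "moment r c i j = (\<Sum>k = 1..r. c ! (r + 1 - k - 1) * ?J (monom 1 i) (sub_recon r (r + 1 - k) ?v))"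
    unfolding moment_def by (subst sum.atLeastAtMost_rev) (simp only: add.commute)
  also have "\<dots> = (\<Sum>k = 1..r. \<sigma> * (-1) ^ (i + j) * (c ! (k - 1) * ?J (monom 1 i) (sub_recon r k ?v)))"
  proof (rule sum.cong[OF refl])
    fix k assume k: "k \<in> {1..r}"
    have "r + 1 - k - 1 = r - k" by simp
    then show "c ! (r + 1 - k - 1) * ?J (monom 1 i) (sub_recon r (r + 1 - k) ?v)
        = \<sigma> * (-1) ^ (i + j) * (c ! (k - 1) * ?J (monom 1 i) (sub_recon r k ?v))"
      using mirror[OF k] sym[OF k] by (simp add: mult_ac)
  qed
  also have "\<dots> = \<sigma> * (-1) ^ (i + j) * moment r c i j"
    by (simp add: moment_def sum_distrib_left)
  finally show ?thesis .
qed

text \<open>The monic polynomial vanishing at the \<open>n + 2\<close> edges of the cells \<open>a, \<dots>, a + n\<close>; its derivative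
has average 0 over each of these cells.\<close>

definition edge_poly :: "nat \<Rightarrow> int \<Rightarrow> real poly" where
  "edge_poly n a = (\<Prod>i\<in>{a..a + int n + 1}. [:- (of_int i - 1/2), 1:])"

lemma edge_poly_zero: "i \<in> {a..a + int n + 1} \<Longrightarrow> poly (edge_poly n a) (of_int i - 1/2) = 0"
  by (auto simp: edge_poly_def poly_prod prod_zero_iff)

lemma degree_edge_poly: "degree (edge_poly n a) = n + 2"
  and lead_coeff_edge_poly: "lead_coeff (edge_poly n a) = 1"
proof -
  show "degree (edge_poly n a) = n + 2"
    unfolding edge_poly_def by (subst degree_prod_eq_sum_degree) auto
  show "lead_coeff (edge_poly n a) = 1" by (simp add: edge_poly_def lead_coeff_prod)
qed

text \<open>The error of reconstructing the first monomial that is not reproduced has average 0 over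
all the cells and leading coefficient 1. This determines it as a multiple of the derivative of
the edge polynomial.\<close>

lemma recon_next_monom:
  "recon n a (unit_average (monom 1 (n + 1)))
    = monom 1 (n + 1) - smult (1 / (real n + 2)) (pderiv (edge_poly n a))"
proof (rule recon_unique)
  let ?q = "monom 1 (n + 1) - smult (1 / (real n + 2)) (pderiv (edge_poly n a))"
  have "coeff ?q i = 0" if "i > n" for i
  proof (cases "i = n + 1")
    case True
    then show ?thesis
      using lead_coeff_edge_poly[of n a] by (simp add: degree_edge_poly coeff_pderiv field_simps)
  next
    case False
    with that have "coeff (edge_poly n a) (Suc i) = 0"
      by (intro coeff_eq_0) (simp add: degree_edge_poly)
    with False show ?thesis by (simp add: coeff_pderiv)
  qed
  then show "degree ?q \<le> n" by (intro degree_le) auto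
  show "unit_average ?q j = unit_average (monom 1 (n + 1)) j" if "j \<in> {a..a + int n}" for j
    using edge_poly_zero[of j a n] edge_poly_zero[of "j + 1" a n] that
    by (simp add: unit_average_diff unit_average_smult unit_average_pderiv add.commute)
qed

lemma prod_diff_int:
  "(\<Prod>i\<in>{m - int p..m + int q} - {m}. real_of_int m - of_int i) = (-1) ^ q * fact p * fact q"
proof -
  have "{m - int p..m + int q} - {m} = {m - int p..m - 1} \<union> {m + 1..m + int q}" by auto
  then have "(\<Prod>i\<in>{m - int p..m + int q} - {m}. real_of_int m - of_int i)
      = (\<Prod>i\<in>{m - int p..m - 1}. real_of_int m - of_int i) * (\<Prod>i\<in>{m + 1..m + int q}. real_of_int m - of_int i)"
    by (simp only:) (subst prod.union_disjoint; auto)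
  also have "(\<Prod>i\<in>{m - int p..m - 1}. real_of_int m - of_int i) = (\<Prod>l\<in>{1..p}. real l)"
    by (rule prod.reindex_bij_witness[of _ "\<lambda>l. m - int l" "\<lambda>i. nat (m - i)"]) auto
  also have "(\<Prod>i\<in>{m + 1..m + int q}. real_of_int m - of_int i) = (\<Prod>l\<in>{1..q}. (-1) * real l)"
    by (rule prod.reindex_bij_witness[of _ "\<lambda>l. m + int l" "\<lambda>i. nat (i - m)"]) auto
  also have "\<dots> = (-1) ^ q * (\<Prod>l\<in>{1..q}. real l)" by (subst prod.distrib) simp
  finally show ?thesis by (simp add: fact_prod)
qed

text \<open>At a zero of a product of distinct linear factors, the derivative is the product of the
other factors, here with \<open>p\<close> edges to the left and \<open>q\<close> to the right.\<close>

lemma poly_pderiv_edge_poly: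
  assumes "p + q = n + 1"
  shows "poly (pderiv (edge_poly n (m - int p))) (of_int m - 1/2) = (-1) ^ q * fact p * fact q"
proof -
  let ?I = "{m - int p..m + int q}"
  let ?f = "\<lambda>i. [:- (of_int i - 1/2), 1:] :: real poly"
  have "m - int p + int n + 1 = m + int q" using assms by linarith
  then have "edge_poly n (m - int p) = (\<Prod>i\<in>?I. ?f i)" by (simp only: edge_poly_def)
  then have "poly (pderiv (edge_poly n (m - int p))) (of_int m - 1/2)
      = (\<Sum>b\<in>?I. \<Prod>i\<in>?I - {b}. real_of_int m - of_int i)"
    by (simp add: pderiv_prod poly_sum poly_prod pderiv_pCons)
  also have "\<dots> = (\<Sum>b\<in>{m}. \<Prod>i\<in>?I - {b}. real_of_int m - of_int i)"
    by (rule sum.mono_neutral_right) (auto simp: prod_zero_iff)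
  finally show ?thesis using prod_diff_int[of m p q] by simp
qed

text \<open>Pairing with \<open>y\<close> takes the difference of the reconstruction error at \<open>1/2\<close> and \<open>-1/2\<close>. Both are
cell edges of the substencil, so the derivative of the edge polynomial is a signed product of
factorials at either point, and the two add up to a multiple of \<open>r + 1\<close> that cancels the
leading coefficient of the derivative.\<close>

lemma jiang_shu_linear_recon:
  assumes "r \<ge> 2" "k \<in> {1..r}"
  shows "jiang_shu (r - 1) (monom 1 1) (sub_recon r k (unit_average (monom 1 r)))
    = jiang_shu (r - 1) (monom 1 1) (monom 1 r) + (-1) ^ k * fact (k - 1) * fact (r - k)"
proof -
  let ?W = "pderiv (edge_poly (r - 1) (int k - int r))"
  have "poly ?W (1/2) = (-1) ^ (k - 1) * fact (r - k + 1) * fact (k - 1)"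
    using assms poly_pderiv_edge_poly[of "r - k + 1" "k - 1" "r - 1" 1] by (simp add: of_nat_diff)
  also have "\<dots> = - ((-1) ^ k) * (real (r - k) + 1) * fact (r - k) * fact (k - 1)"
    using assms by (cases k) auto
  finally have right: "poly ?W (1/2) = - ((-1) ^ k) * (real (r - k) + 1) * fact (r - k) * fact (k - 1)" .
  have "poly ?W (- 1/2) = (-1) ^ k * fact (r - k) * fact k"
    using assms poly_pderiv_edge_poly[of "r - k" k "r - 1" 0] by (simp add: of_nat_diff)
  also have "fact k = real k * fact (k - 1)"
    using assms fact_reduce[of k] by simp
  finally have left: "poly ?W (- 1/2) = (-1) ^ k * fact (r - k) * (real k * fact (k - 1))" .
  have rk: "real (r - k) = real r - real k" using assms by (simp add: of_nat_diff)
  have split: "sub_recon r k (unit_average (monom 1 r)) = monom 1 r - smult (1 / (real r + 1)) ?W"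
    using recon_next_monom[of "r - 1" "int k - int r"] assms by (simp add: of_nat_diff add.commute)
  have deriv: "jiang_shu (r - 1) (monom 1 1) ?W = - (real r + 1) * ((-1) ^ k * fact (k - 1) * fact (r - k))"
  proof -
    have "jiang_shu (r - 1) (monom 1 1) ?W = poly ?W (1/2) - poly ?W (- 1/2)"
      using assms(1) by (intro jiang_shu_linear) simp
    then show ?thesis unfolding right left rk by (simp add: algebra_simps)
  qed
  have cancel: "y - 1 / s * (- s * x) = y + x" if "s > 0" for x y s :: real
    using that by simp
  show ?thesis
    unfolding split jiang_shu_diff_right jiang_shu_smult_right deriv by (rule cancel) simp
qed

lemma moment_1_r:
  assumes "r \<ge> 2" "(\<Sum>k = 1..r. c ! (k - 1)) = 0"
  shows "moment r c 1 r = (\<Sum>k = 1..r. c ! (k - 1) * ((-1) ^ k * fact (k - 1) * fact (r - k)))"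
proof -
  have "moment r c 1 r = (\<Sum>k = 1..r. c ! (k - 1)) * jiang_shu (r - 1) (monom 1 1) (monom 1 r)
      + (\<Sum>k = 1..r. c ! (k - 1) * ((-1) ^ k * fact (k - 1) * fact (r - k)))"
    unfolding moment_def sum_distrib_right sum.distrib[symmetric]
    using assms(1) by (intro sum.cong refl) (simp only: jiang_shu_linear_recon distrib_left)
  then show ?thesis using assms(2) by simp
qed

text \<open>With \<open>i + j < \<theta> \<le> r + 3\<close> and \<open>j \<ge> r\<close> only the pairs \<open>(1, r)\<close>, \<open>(1, r + 1)\<close> and \<open>(2, r)\<close> remain. For
the last two the symmetry of \<open>c\<close> meets the parity of \<open>r + 2\<close>, and the product of signs is -1.\<close>

lemma moments_vanish:
  assumes "r \<ge> 2" "\<theta> \<le> r + 3"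
    and csum: "(\<Sum>k = 1..r. c ! (k - 1)) = 0"
    and alt: "\<theta> > r + 1 \<Longrightarrow> (\<Sum>k = 1..r. c ! (k - 1) * ((-1) ^ k * fact (k - 1) * fact (r - k))) = 0"
    and sym: "\<And>k. \<theta> > r + 2 \<Longrightarrow> k \<in> {1..r} \<Longrightarrow> c ! (r - k) = (-1) ^ (r + 1) * c ! (k - 1)"
    and ij: "1 \<le> i" "i + j < \<theta>"
  shows "moment r c i j = 0"
proof -
  consider "j < r" | "i = 1" "j = r" "\<theta> > r + 1" | "i + j = r + 2" "\<theta> > r + 2"
    using ij assms(2) by linarith
  then show ?thesis
  proof cases
    case 1
    then show ?thesis using assms(1) csum by (intro moment_low_degree) auto
  next
    case 2
    then show ?thesis using moment_1_r[OF assms(1) csum] alt by simp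
  next
    case 3
    have "moment r c i j = (-1) ^ (r + 1) * (-1) ^ (i + j) * moment r c i j"
      using assms(1) sym[OF 3(2)] by (intro moment_reflect) auto
    also have "(-1) ^ (r + 1) * (-1) ^ (i + j) = (-1 :: real)"
      unfolding 3(1) by simp
    finally show ?thesis by simp
  qed
qed

text \<open>The second and third condition are claimed only where the tabulated order exceeds \<open>r + 1\<close> and
\<open>r + 2\<close>: the entry with \<open>r = 2\<close> violates the second, and the standard choices violate the
third, having the opposite symmetry.\<close>

lemma tau_tables:
  assumes "(r, c, \<theta>) \<in> tau_standard \<union> tau_optimal"
  shows "r \<ge> 2" "\<theta> \<le> 2 * r" "\<theta> \<le> r + 3"
    and "(\<Sum>k = 1..r. c ! (k - 1)) = 0"
    and "\<theta> > r + 1 \<Longrightarrow> (\<Sum>k = 1..r. c ! (k - 1) * ((-1) ^ k * fact (k - 1) * fact (r - k))) = 0"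
    and "\<theta> > r + 2 \<Longrightarrow> k \<in> {1..r} \<Longrightarrow> c ! (r - k) = (-1) ^ (r + 1) * c ! (k - 1)"
proof -
  show "r \<ge> 2" "\<theta> \<le> 2 * r" "\<theta> \<le> r + 3"
    using assms by (auto simp: tau_standard_def tau_optimal_def)
  show "(\<Sum>k = 1..r. c ! (k - 1)) = 0"
    using assms by (auto simp: tau_standard_def tau_optimal_def eval_nat_numeral)
  show "(\<Sum>k = 1..r. c ! (k - 1) * ((-1) ^ k * fact (k - 1) * fact (r - k))) = 0" if "\<theta> > r + 1"
    using assms that by (auto simp: tau_standard_def tau_optimal_def eval_nat_numeral)
  show "c ! (r - k) = (-1) ^ (r + 1) * c ! (k - 1)" if "\<theta> > r + 2" "k \<in> {1..r}"
  proof -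
    have "k \<in> {1, 2, 3, 4, 5, 6}"
      using assms that(2) by (auto simp: tau_standard_def tau_optimal_def)
    then show ?thesis
      using assms that by (auto simp: tau_standard_def tau_optimal_def)
  qed
qed

section \<open>Combinations of approximating polynomials\<close>

lemma approximates_mono:
  assumes "approximates n P u" "m \<le> n"
  shows "approximates m P u"
proof -
  obtain K where K: "\<forall>\<^sub>F h in at_right 0. \<forall>x\<in>cell h 0. \<bar>poly (P h) x - u x\<bar> \<le> K * h ^ n"
    using assms(1) unfolding approximates_def by blast
  have "\<forall>\<^sub>F h in at_right 0. h < (1 :: real)"
    by (intro eventually_at_rightI[of 0 1]) auto
  with K eventually_at_right_less[of 0]
  have "\<forall>\<^sub>F h in at_right 0. \<forall>x\<in>cell h 0. \<bar>poly (P h) x - u x\<bar> \<le> \<bar>K\<bar> * h ^ m"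
  proof eventually_elim
    case (elim h)
    have "K * h ^ n \<le> \<bar>K\<bar> * h ^ n" using elim(2) by (intro mult_right_mono) auto
    also have "\<dots> \<le> \<bar>K\<bar> * h ^ m"
      using elim(2,3) assms(2) by (intro mult_left_mono power_decreasing) auto
    finally show ?case using elim(1) order_trans by blast
  qed
  then show ?thesis unfolding approximates_def by blast
qed

text \<open>The decomposition behind the whole argument: since the two families of weights have equal
sums, \<open>u\<close> may be subtracted from each \<open>P\<^sub>k\<close>, and the deviation of a weight, of order \<open>h^n\<close>,
multiplies an error of order \<open>h^m\<close>.\<close>

lemma approximates_perturbed_combination:
  assumes fin: "finite A"
    and base: "approximates (m + n) (\<lambda>h. \<Sum>k\<in>A. smult (d k) (P k h)) u"
    and P: "\<And>k. k \<in> A \<Longrightarrow> approximates m (P k) u"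
    and sums: "\<And>h. h > 0 \<Longrightarrow> (\<Sum>k\<in>A. w h k) = (\<Sum>k\<in>A. d k)"
    and close: "\<forall>\<^sub>F h in at_right 0. \<forall>k\<in>A. \<bar>w h k - d k\<bar> \<le> B * h ^ n"
  shows "approximates (m + n) (\<lambda>h. \<Sum>k\<in>A. smult (w h k) (P k h)) u"
proof -
  obtain K0 where K0: "\<forall>\<^sub>F h in at_right 0. \<forall>x\<in>cell h 0.
      \<bar>poly (\<Sum>k\<in>A. smult (d k) (P k h)) x - u x\<bar> \<le> K0 * h ^ (m + n)"
    using base unfolding approximates_def by blast
  have "\<exists>K. \<forall>k\<in>A. \<forall>\<^sub>F h in at_right 0. \<forall>x\<in>cell h 0. \<bar>poly (P k h) x - u x\<bar> \<le> K k * h ^ m"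
    using P unfolding approximates_def by (intro bchoice) blast
  then obtain K where "\<forall>k\<in>A. \<forall>\<^sub>F h in at_right 0. \<forall>x\<in>cell h 0. \<bar>poly (P k h) x - u x\<bar> \<le> K k * h ^ m"
    by blast
  then have "\<forall>\<^sub>F h in at_right 0. \<forall>k\<in>A. \<forall>x\<in>cell h 0. \<bar>poly (P k h) x - u x\<bar> \<le> K k * h ^ m"
    using fin by (simp add: eventually_ball_finite)
  with K0 close eventually_at_right_less[of 0]
  have "\<forall>\<^sub>F h in at_right 0. \<forall>x\<in>cell h 0. \<bar>poly (\<Sum>k\<in>A. smult (w h k) (P k h)) x - u x\<bar>
      \<le> (K0 + (\<Sum>k\<in>A. B * K k)) * h ^ (m + n)"
  proof eventually_elim
    case (elim h)
    show ?case
    proof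
      fix x assume x: "x \<in> cell h 0"
      have "poly (\<Sum>k\<in>A. smult (w h k) (P k h)) x - poly (\<Sum>k\<in>A. smult (d k) (P k h)) x
          = (\<Sum>k\<in>A. (w h k - d k) * poly (P k h) x)"
        by (simp add: poly_sum left_diff_distrib sum_subtractf)
      also have "\<dots> = (\<Sum>k\<in>A. (w h k - d k) * (poly (P k h) x - u x))"
        using sums[OF elim(3)]
        by (simp add: right_diff_distrib sum_subtractf flip: sum_distrib_right)
      finally have diff: "poly (\<Sum>k\<in>A. smult (w h k) (P k h)) x
          - poly (\<Sum>k\<in>A. smult (d k) (P k h)) x
          = (\<Sum>k\<in>A. (w h k - d k) * (poly (P k h) x - u x))" .
      have "\<bar>\<Sum>k\<in>A. (w h k - d k) * (poly (P k h) x - u x)\<bar>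
          \<le> (\<Sum>k\<in>A. (B * h ^ n) * (K k * h ^ m))"
      proof (rule order_trans[OF sum_abs], rule sum_mono)
        fix k assume k: "k \<in> A"
        have "\<bar>w h k - d k\<bar> \<le> B * h ^ n" "\<bar>poly (P k h) x - u x\<bar> \<le> K k * h ^ m"
          using elim(2,4) k x by auto
        then show "\<bar>(w h k - d k) * (poly (P k h) x - u x)\<bar> \<le> (B * h ^ n) * (K k * h ^ m)"
          unfolding abs_mult by (intro mult_mono') auto
      qed
      also have "\<dots> = (\<Sum>k\<in>A. B * K k) * h ^ (m + n)"
        by (subst sum_distrib_right) (intro sum.cong refl, simp add: power_add)
      finally have "\<bar>poly (\<Sum>k\<in>A. smult (w h k) (P k h)) x
          - poly (\<Sum>k\<in>A. smult (d k) (P k h)) x\<bar> \<le> (\<Sum>k\<in>A. B * K k) * h ^ (m + n)"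
        unfolding diff .
      moreover have "\<bar>poly (\<Sum>k\<in>A. smult (d k) (P k h)) x - u x\<bar> \<le> K0 * h ^ (m + n)"
        using elim(1) x by blast
      ultimately show "\<bar>poly (\<Sum>k\<in>A. smult (w h k) (P k h)) x - u x\<bar>
          \<le> (K0 + (\<Sum>k\<in>A. B * K k)) * h ^ (m + n)"
        unfolding distrib_right by linarith
    qed
  qed
  then show ?thesis unfolding approximates_def by blast
qed

lemma weight_total_ge_1:
  fixes d \<beta> :: "nat \<Rightarrow> real"
  assumes "\<And>k. k \<in> A \<Longrightarrow> d k \<ge> 0" "(\<Sum>k\<in>A. d k) = 1" "\<And>k. k \<in> A \<Longrightarrow> \<beta> k \<ge> 0"
  shows "(\<Sum>k\<in>A. d k * (1 + \<beta> k)) \<ge> 1"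
proof -
  have "(\<Sum>k\<in>A. d k) \<le> (\<Sum>k\<in>A. d k * (1 + \<beta> k))"
    using assms(1,3) by (intro sum_mono) (simp add: distrib_left)
  then show ?thesis using assms(2) by simp
qed

text \<open>With \<open>S = \<Sum>\<^sub>i d\<^sub>i \<beta>\<^sub>i\<close> the deviation equals \<open>d\<^sub>k (\<beta>\<^sub>k - S) / (1 + S)\<close>, and \<open>S\<close>, being an average of the
\<open>\<beta>\<^sub>i\<close>, lies in \<open>[0, B]\<close> like \<open>\<beta>\<^sub>k\<close>.\<close>

lemma normalised_weight_deviation:
  fixes d \<beta> :: "nat \<Rightarrow> real"
  assumes "finite A" "\<And>k. k \<in> A \<Longrightarrow> d k \<ge> 0" "(\<Sum>k\<in>A. d k) = 1"
    and \<beta>: "\<And>k. k \<in> A \<Longrightarrow> 0 \<le> \<beta> k \<and> \<beta> k \<le> B" and "k \<in> A"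
  shows "\<bar>d k * (1 + \<beta> k) / (\<Sum>i\<in>A. d i * (1 + \<beta> i)) - d k\<bar> \<le> B"
proof -
  define S where "S = (\<Sum>i\<in>A. d i * \<beta> i)"
  have S0: "S \<ge> 0" unfolding S_def using assms(2) \<beta> by (intro sum_nonneg) auto
  have "S \<le> (\<Sum>i\<in>A. d i * B)" unfolding S_def using assms(2) \<beta> by (intro sum_mono mult_left_mono) auto
  then have SB: "S \<le> B" using assms(3) by (simp flip: sum_distrib_right)
  have total: "(\<Sum>i\<in>A. d i * (1 + \<beta> i)) = 1 + S"
    using assms(3) by (simp add: S_def distrib_left sum.distrib)
  have d1: "d k \<le> 1" using assms member_le_sum[of k A d] by auto
  have "d k * (1 + \<beta> k) / (1 + S) - d k = d k * (\<beta> k - S) / (1 + S)"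
    using S0 by (simp add: field_simps)
  also have "\<bar>\<dots>\<bar> = d k * \<bar>\<beta> k - S\<bar> / (1 + S)"
    using S0 assms(2)[OF assms(5)] by (simp add: abs_mult)
  also have "\<dots> \<le> 1 * B / 1"
  proof (rule frac_le)
    have "\<bar>\<beta> k - S\<bar> \<le> B" using \<beta>[OF assms(5)] S0 SB by linarith
    then show "d k * \<bar>\<beta> k - S\<bar> \<le> 1 * B"
      using d1 assms(2)[OF assms(5)] by (intro mult_mono) auto
    show "0 \<le> 1 * B" using S0 SB by simp
  qed (use S0 in auto)
  finally show ?thesis by (simp add: total)
qed

text \<open>Dropping \<open>I \<ge> 0\<close> from the denominator leaves a quotient of order \<open>h powr (\<theta> - \<theta>\<epsilon>)\<close>, and the
condition on the exponents is \<open>(\<theta> - \<theta>\<epsilon>) t \<ge> n\<close>. The bound is uniform in \<open>I\<close>, so that one constant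
serves all the weights.\<close>

lemma powr_ratio_bound:
  fixes \<tau> \<epsilon> :: "real \<Rightarrow> real" and \<theta> n :: nat
  assumes \<tau>: "\<tau> \<in> O[at_right 0](\<lambda>h. h ^ \<theta>)"
    and "t > 0" "C > 0"
    and \<epsilon>: "\<epsilon> \<sim>[at_right 0] (\<lambda>h. C * h powr \<theta>\<epsilon>)"
    and exponent: "\<theta>\<epsilon> \<le> real \<theta> - real n / t"
  obtains B where "\<forall>\<^sub>F h in at_right 0. \<forall>I\<ge>0. (\<bar>\<tau> h\<bar> / (I + \<epsilon> h)) powr t \<le> B * h ^ n"
proof -
  obtain K where K: "K > 0" "\<forall>\<^sub>F h in at_right 0. \<bar>\<tau> h\<bar> \<le> K * h ^ \<theta>"
    using bigo_at_right_powerD[OF \<tau>] .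
  have "\<forall>\<^sub>F h in at_right 0. (if \<epsilon> h = 0 \<and> C * h powr \<theta>\<epsilon> = 0 then 1 else \<epsilon> h / (C * h powr \<theta>\<epsilon>)) > 1/2"
    using \<epsilon> unfolding asymp_equiv_def by (rule order_tendstoD) simp
  moreover have "\<forall>\<^sub>F h in at_right 0. h < (1 :: real)"
    by (intro eventually_at_rightI[of 0 1]) auto
  ultimately have "\<forall>\<^sub>F h in at_right 0. \<forall>I\<ge>0. (\<bar>\<tau> h\<bar> / (I + \<epsilon> h)) powr t \<le> (2 * K / C) powr t * h ^ n"
    using K(2) eventually_at_right_less[of 0]
  proof eventually_elim
    case (elim h)
    have h: "0 < h" "h < 1" using elim by auto
    have pos: "C * h powr \<theta>\<epsilon> > 0" using assms(3) h by simp
    then have nz: "(\<epsilon> h = 0 \<and> C * h powr \<theta>\<epsilon> = 0) = False" by (metis less_irrefl)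
    have "\<epsilon> h / (C * h powr \<theta>\<epsilon>) > 1/2" using elim(1) unfolding nz if_False .
    then have eps: "\<epsilon> h > C / 2 * h powr \<theta>\<epsilon>" using pos by (simp add: field_simps)
    have eps_pos: "C / 2 * h powr \<theta>\<epsilon> > 0" using pos by simp
    show ?case
    proof (intro allI impI)
      fix I :: real assume I: "I \<ge> 0"
      have "\<bar>\<tau> h\<bar> / (I + \<epsilon> h) \<le> (K * h ^ \<theta>) / (C / 2 * h powr \<theta>\<epsilon>)"
        using elim(3) eps eps_pos I K(1) h by (intro frac_le) auto
      also have "\<dots> = 2 * K / C * h powr (real \<theta> - \<theta>\<epsilon>)"
        using h by (simp add: powr_diff powr_realpow)
      finally have ratio: "\<bar>\<tau> h\<bar> / (I + \<epsilon> h) \<le> 2 * K / C * h powr (real \<theta> - \<theta>\<epsilon>)" .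
      have "0 \<le> \<bar>\<tau> h\<bar> / (I + \<epsilon> h)" using eps eps_pos I by simp
      then have "(\<bar>\<tau> h\<bar> / (I + \<epsilon> h)) powr t \<le> (2 * K / C * h powr (real \<theta> - \<theta>\<epsilon>)) powr t"
        using ratio assms(2) by (intro powr_mono2) auto
      also have "\<dots> = (2 * K / C) powr t * h powr ((real \<theta> - \<theta>\<epsilon>) * t)"
        using K(1) assms(3) by (subst powr_mult) (simp_all add: powr_powr)
      also have "h powr ((real \<theta> - \<theta>\<epsilon>) * t) \<le> h powr real n"
      proof (rule powr_mono')
        have "real n / t \<le> real \<theta> - \<theta>\<epsilon>" using exponent by simp
        then show "real n \<le> (real \<theta> - \<theta>\<epsilon>) * t" using assms(2) by (simp add: field_simps)
      qed (use h in auto)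
      also have "h powr real n = h ^ n" using h by (simp add: powr_realpow)
      finally show "(\<bar>\<tau> h\<bar> / (I + \<epsilon> h)) powr t \<le> (2 * K / C) powr t * h ^ n"
        by (simp add: mult_left_mono)
    qed
  qed
  then show thesis by (rule that)
qed

section \<open>The CWENOZ reconstruction\<close>

lemma approximates_P_opt:
  assumes "r \<ge> 1" "C_k_on (2 * r - 1) u {-\<delta><..<\<delta>}" "\<delta> > 0"
  shows "approximates (2 * r - 1) (\<lambda>h. P_opt u h r) u"
proof -
  have "Suc (2 * r - 2) = 2 * r - 1" "- int r + 1 + int (2 * r - 2) = int r - 1"
    using assms(1) by auto
  with approximates_interpolant[of "2 * r - 2" u \<delta> "- int r + 1"] assms(2,3)
  show ?thesis by (simp only: P_opt_def)
qed

lemma approximates_P_sub: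
  assumes "r \<ge> 1" "C_k_on (2 * r - 1) u {-\<delta><..<\<delta>}" "\<delta> > 0"
  shows "approximates r (\<lambda>h. P_sub u h r k) u"
proof -
  have "C_k_on r u {-\<delta><..<\<delta>}" using assms(1) by (intro C_k_on_mono[OF assms(2)]) auto
  moreover have "Suc (r - 1) = r" using assms(1) by simp
  ultimately show ?thesis
    using approximates_interpolant[of "r - 1" u \<delta> "int k - int r"] assms(3)
    by (simp only: P_sub_eq_interpolant[OF assms(1)])
qed

lemma sum_P_cwenoz:
  assumes "d 0 \<noteq> 0"
  shows "(\<Sum>k = 0..r. smult (d k) (P_cwenoz u h r d k)) = P_opt u h r"
proof -
  have "(\<Sum>k = 0..r. smult (d k) (P_cwenoz u h r d k))
      = smult (d 0) (P_cwenoz u h r d 0) + (\<Sum>k = 1..r. smult (d k) (P_cwenoz u h r d k))"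
    by (simp add: sum.atLeast_Suc_atMost)
  also have "(\<Sum>k = 1..r. smult (d k) (P_cwenoz u h r d k)) = (\<Sum>k = 1..r. smult (d k) (P_sub u h r k))"
    by (intro sum.cong refl) (auto simp: P_cwenoz_def)
  finally show ?thesis using assms by (simp add: P_cwenoz_def)
qed

lemma approximates_P_cwenoz:
  assumes "r \<ge> 1" "C_k_on (2 * r - 1) u {-\<delta><..<\<delta>}" "\<delta> > 0"
    and "d 0 \<noteq> 0" "(\<Sum>k = 0..r. d k) = 1"
  shows "approximates r (\<lambda>h. P_cwenoz u h r d k) u"
proof (cases "k = 0")
  case False
  then show ?thesis using approximates_P_sub[OF assms(1-3)] by (simp add: P_cwenoz_def)
next
  case True
  \<comment> \<open>\<open>P\<^sub>0\<close> is a combination of \<open>P_opt\<close> and the \<open>P\<^sub>i\<close> with weights \<open>?w\<close> of sum 1. It is compared with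
    \<open>P_opt\<close> alone, weights \<open>?e\<close>, as a perturbation of order \<open>h^0\<close>.\<close>
  let ?P = "\<lambda>i h. if i = 0 then P_opt u h r else P_sub u h r i"
  let ?e = "\<lambda>i. if i = 0 then 1 else (0 :: real)"
  let ?w = "\<lambda>i. if i = 0 then 1 / d 0 else - d i / d 0"
  define B where "B = (\<Sum>i = 0..r. \<bar>?w i - ?e i\<bar>)"
  have opt: "approximates r (\<lambda>h. P_opt u h r) u"
    using assms(1) by (intro approximates_mono[OF approximates_P_opt[OF assms(1-3)]]) auto
  have "approximates (r + 0) (\<lambda>h. \<Sum>i = 0..r. smult (?w i) (?P i h)) u"
  proof (rule approximates_perturbed_combination)
    have "(\<Sum>i = 0..r. smult (?e i) (?P i h)) = P_opt u h r" for h
      by (simp add: sum.atLeast_Suc_atMost)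
    then show "approximates (r + 0) (\<lambda>h. \<Sum>i = 0..r. smult (?e i) (?P i h)) u"
      using opt by simp
    show "approximates r (?P i) u" for i
      using opt approximates_P_sub[OF assms(1-3), of i] by (cases "i = 0") auto
    have "(\<Sum>i = 1..r. d i) = 1 - d 0"
      using assms(5) by (simp add: sum.atLeast_Suc_atMost)
    then show "(\<Sum>i = 0..r. ?w i) = (\<Sum>i = 0..r. ?e i)"
      using assms(4) by (simp add: sum.atLeast_Suc_atMost sum_negf diff_divide_distrib flip: sum_divide_distrib)
    show "\<forall>\<^sub>F h in at_right 0. \<forall>i\<in>{0..r}. \<bar>?w i - ?e i\<bar> \<le> B * h ^ 0"
      unfolding B_def by (intro always_eventually allI ballI) (simp only: power_0 mult_1_right, rule member_le_sum, auto)
  qed simp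
  moreover have "(\<Sum>i = 0..r. smult (?w i) (?P i h)) = P_cwenoz u h r d 0" for h
  proof -
    have "(\<Sum>i = 0..r. smult (?w i) (?P i h))
        = smult (1 / d 0) (P_opt u h r) + (\<Sum>i = 1..r. smult (- d i / d 0) (P_sub u h r i))"
      by (simp add: sum.atLeast_Suc_atMost)
    also have "(\<Sum>i = 1..r. smult (- d i / d 0) (P_sub u h r i))
        = - smult (1 / d 0) (\<Sum>i = 1..r. smult (d i) (P_sub u h r i))"
      by (rule poly_eqI) (simp add: coeff_sum sum_distrib_left sum_negf)
    finally show ?thesis by (simp add: P_cwenoz_def smult_diff_right)
  qed
  ultimately show ?thesis using True by simp
qed

theorem proposition2:
  fixes r \<theta>\<tau> :: nat and c :: "real list" and d :: "nat \<Rightarrow> real"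
    and \<epsilon> :: "real \<Rightarrow> real" and t \<theta>\<epsilon> C \<delta> :: real and u :: "real \<Rightarrow> real"
  assumes "r > 1"
    and "(r, c, \<theta>\<tau>) \<in> tau_standard \<union> tau_optimal"
    and "\<forall>k\<in>{0..r}. 0 < d k \<and> d k < 1"
    and "(\<Sum>k = 0..r. d k) = 1"
    and "t \<ge> 1"
    and "\<forall>h>0. \<epsilon> h > 0"
    and "C > 0" and "\<epsilon> \<sim>[at_right 0] (\<lambda>h. C * h powr \<theta>\<epsilon>)"
    and "\<theta>\<epsilon> \<le> real \<theta>\<tau> - (real r - 1) / t"
    and "\<delta> > 0" and "C_k_on (2 * r - 1) u {-\<delta><..<\<delta>}"
  shows "\<exists>K. \<forall>\<^sub>F h in at_right 0. \<forall>x\<in>cell h 0.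
           \<bar>poly (P_rec u h r d c (\<epsilon> h) t) x - u x\<bar> \<le> K * h ^ (2 * r - 1)"
proof -
  note tab = tau_tables[OF assms(2)]
  have tau: "(\<lambda>h. tau u h r c) \<in> O[at_right 0](\<lambda>h. h ^ \<theta>\<tau>)"
    using assms(1,10,11) tab(2)
    by (intro tau_bigo[of r \<theta>\<tau> u \<delta> c] tab(4) moments_vanish[OF tab(1,3,4,5,6)]) auto
  have "\<theta>\<epsilon> \<le> real \<theta>\<tau> - real (r - 1) / t" using assms(1,9) by (simp add: of_nat_diff)
  then obtain B where B: "\<forall>\<^sub>F h in at_right 0. \<forall>I\<ge>0. (\<bar>tau u h r c\<bar> / (I + \<epsilon> h)) powr t \<le> B * h ^ (r - 1)"
    using powr_ratio_bound[OF tau _ assms(7,8), of t "r - 1"] assms(5) by auto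
  define \<beta> where "\<beta> h k = (tau u h r c / (smoothness h (P_cwenoz u h r d k) + \<epsilon> h)) powr t" for h k
  let ?w = "\<lambda>h k. omega_Z u h r d c (\<epsilon> h) t k"
  have w: "?w h k = d k * (1 + \<beta> h k) / (\<Sum>i = 0..r. d i * (1 + \<beta> h i))" for h k
    by (simp add: omega_Z_def alpha_Z_def \<beta>_def)
  have d: "d k \<ge> 0" if "k \<in> {0..r}" for k using assms(3) that less_imp_le by blast
  have d0: "d 0 \<noteq> 0" using assms(3) by force
  have "approximates (r + (r - 1)) (\<lambda>h. \<Sum>k = 0..r. smult (?w h k) (P_cwenoz u h r d k)) u"
  proof (rule approximates_perturbed_combination)
    show "approximates (r + (r - 1)) (\<lambda>h. \<Sum>k = 0..r. smult (d k) (P_cwenoz u h r d k)) u"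
      unfolding sum_P_cwenoz[of d, OF d0]
      using assms(1) by (intro approximates_mono[OF approximates_P_opt[OF _ assms(11,10)]]) auto
    show "approximates r (\<lambda>h. P_cwenoz u h r d k) u" for k
      using assms(1) by (intro approximates_P_cwenoz[OF _ assms(11,10) d0 assms(4)]) simp
    show "(\<Sum>k = 0..r. ?w h k) = (\<Sum>k = 0..r. d k)" if "h > 0" for h
    proof -
      have "(\<Sum>i = 0..r. d i * (1 + \<beta> h i)) \<ge> 1"
        using d assms(4) by (intro weight_total_ge_1) (auto simp: \<beta>_def)
      then show ?thesis unfolding w assms(4) by (simp flip: sum_divide_distrib)
    qed
    show "\<forall>\<^sub>F h in at_right 0. \<forall>k\<in>{0..r}. \<bar>?w h k - d k\<bar> \<le> B * h ^ (r - 1)"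
      using B eventually_at_right_less[of 0]
    proof eventually_elim
      case (elim h)
      have "0 \<le> \<beta> h k \<and> \<beta> h k \<le> B * h ^ (r - 1)" for k
        using elim(1)[rule_format, OF smoothness_nonneg[OF elim(2)], of "P_cwenoz u h r d k"]
        by (simp add: \<beta>_def tau_def)
      then show ?case
        unfolding w using d assms(4) by (intro ballI normalised_weight_deviation) auto
    qed
  qed simp
  moreover have "r + (r - 1) = 2 * r - 1" by simp
  ultimately show ?thesis by (simp only: P_rec_def approximates_def)
qed

end
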